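(* Let $n,p\ge 1$ be integers and let $(X_i)_{i\in\mathbb Z}$ be the $p$-dimensional stationary linear process $X_i=\mu+\sum_{k=0}^\infty A_k\boldsymbol\varepsilon_{i-k}$, where $\mu\in\mathbb R^p$, $A_0=I_p$, the $A_k$ ($k\ge1$) are real $p\times p$ matrices, $\boldsymbol\varepsilon_i=(\varepsilon_{i1},\dots,\varepsilon_{ip})^\top$, and $\varepsilon_{ij}$ ($i\in\mathbb Z$, $1\le j\le p$) are i.i.d. random variables with $\mathbb E\varepsilon_{ij}=0$ and $\mathbb E\varepsilon_{ij}^2=\sigma^2<\infty$. Suppose that there are $0<\rho_0<1$, $1\le\gamma<\infty$ and $1\le\tau\le n$ such that the spectral norms satisfy $\|A_k\|\le\gamma\rho_0^{k/\tau}$ for all $k\ge0$. Let $G:\mathbb R^p\to\mathbb R$ satisfy $|G(u)|\le M$ for all $u\in\mathbb R^p$, and suppose there is a vector $g=(g_1,\dots,g_p)^\top$ with $g_i\ge0$ and $\sum_{i=1}^pg_i=1$ such that for all $u,v\in\mathbb R^p$ $$|G(u)-G(v)|\le\sum_{i=1}^pg_i|u_i-v_i|.$$ Then for any $x>0$, $$\mathbb P\Big(\sum_{i=1}^n\big(G(X_i)-\mathbb EG(X_i)\big)\ge x\Big)\le2\exp\Big\{-\frac{x^2}{C_1n\sigma^2\tau^2\gamma^2+C_2\tau Mx}\Big\},$$ where $$C_1=\frac{16e^2}{\sqrt{2\pi}\,\rho_0^4[\log(1/\rho_0)]^3},\qquad C_2=\frac{8e}{\log(1/\rho_0)}.$$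
   Context: $\|A\|=\sup_{|x|_2\ne0}|Ax|_2/|x|_2$ denotes the spectral norm. *)

theory Defs
  imports "HOL-Probability.Probability"
begin

(* The infinite sum is taken pointwise in \<omega>.  For innovations with bounded second moments
   and coefficient matrices with summable operator norms the series converges almost surely,
   so the arbitrary value of a divergent suminf matters only on a null set. *)
definition linear_process ::
  "real ^ 'p \<Rightarrow> (nat \<Rightarrow> real ^ 'p ^ 'p) \<Rightarrow> (int \<Rightarrow> 'p::finite \<Rightarrow> 'a \<Rightarrow> real) \<Rightarrow> int \<Rightarrow> 'a \<Rightarrow> real ^ 'p"
  where "linear_process \<mu> A \<epsilon> i \<omega> = \<mu> + (\<Sum>k. A k *v (\<chi> j. \<epsilon> (i - int k) j \<omega>))"

definition C1 :: "real \<Rightarrow> real"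
  where "C1 \<rho> = 16 * (exp 1)\<^sup>2 / (sqrt (2 * pi) * \<rho> ^ 4 * (ln (1 / \<rho>)) ^ 3)"

definition C2 :: "real \<Rightarrow> real"
  where "C2 \<rho> = 8 * exp 1 / ln (1 / \<rho>)"

end

theory Submission
  imports Defs
begin

text \<open>
  Truncate the process to \<open>k < K\<close>, so that \<open>\<Sum>i G (X\<^sub>i)\<close> becomes a function \<open>f\<close> of finitely many independent
  innovations \<open>\<epsilon>\<^sub>m\<^sub>j\<close>. Replacing the value \<open>y\<close> of \<open>\<epsilon>\<^sub>m\<^sub>j\<close> by \<open>y'\<close> changes \<open>f\<close> by at most
  \<open>W\<^sub>m\<^sub>j = \<Sum>i min (2 M) (c (i - m) j * \<bar>y - y'\<bar>)\<close> with \<open>c k j = \<Sum>l g\<^sub>l \<bar>A\<^sub>k l j\<bar>\<close>. Integrating out one coordinate at a time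
  and symmetrizing gives \<open>E exp (\<lambda> (f - E f)) \<le> \<Prod> E cosh (\<lambda> W\<^sub>m\<^sub>j)\<close>. Writing \<open>r = \<rho>\<^sub>0 powr (2 / (\<tau> q))\<close>, Jensen's
  inequality with weights \<open>r ^ (i - m)\<close> and \<open>\<Sum>j (c k j)\<^sup>2 \<le> \<gamma>\<^sup>2 r ^ (k q)\<close> bound the sum of the \<open>q\<close>-th powers of all \<open>W\<^sub>m\<^sub>j\<close> by
  \<open>n \<gamma>\<^sup>2 (y - y')\<^sup>2 (2 M) ^ (q - 2) / (1 - r) ^ q\<close>, which makes the cosh series geometric. The resulting
  exponential moment bound does not depend on \<open>K\<close>, so it passes to the limit, and Markov's
  inequality with \<open>\<lambda> = 2 x / D\<close>, where \<open>D\<close> is the denominator in the claim, concludes.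
\<close>

section \<open>Exponential moments under bounded differences\<close>

text \<open>The one-coordinate step. Symmetrization replaces \<open>exp\<close> by the even function
  \<open>cosh\<close>, so the first-order term in \<open>W\<close> disappears and bounds on second
  and higher moments suffice later. The uniform bounds \<open>B\<close> and \<open>B'\<close>
  provide integrability.\<close>

lemma (in prob_space) exp_integral_symmetrization:
  fixes h :: "'a \<Rightarrow> real" and W :: "'a \<times> 'a \<Rightarrow> real"
  assumes [measurable]: "h \<in> borel_measurable M" "W \<in> borel_measurable (M \<Otimes>\<^sub>M M)"
    and h_bound: "\<And>y. y \<in> space M \<Longrightarrow> \<bar>h y\<bar> \<le> B"
    and W_bound: "\<And>p. p \<in> space (M \<Otimes>\<^sub>M M) \<Longrightarrow> \<bar>W p\<bar> \<le> B'"
    and h_W: "\<And>y y'. y \<in> space M \<Longrightarrow> y' \<in> space M \<Longrightarrow> \<bar>h y - h y'\<bar> \<le> W (y, y')"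
  shows "(\<integral>y. exp (h y) \<partial>M) \<le> exp (\<integral>y. h y \<partial>M) * (\<integral>p. cosh (W p) \<partial>(M \<Otimes>\<^sub>M M))"
proof -
  interpret MM: pair_prob_space M M ..
  have int_h: "integrable M h"
    by (rule integrable_const_bound[where B = B]) (use h_bound in auto)
  have int_exp: "integrable M (\<lambda>y. exp (h y))"
    by (rule integrable_const_bound[where B = "exp B"]) (use h_bound in \<open>force intro!: AE_I2\<close>, simp)
  have int_exp': "integrable M (\<lambda>y. exp (- h y))"
    by (rule integrable_const_bound[where B = "exp B"]) (use h_bound in \<open>force intro!: AE_I2\<close>, simp)
  \<comment> \<open>With an independent copy \<open>h'\<close> this gives \<open>E exp (h - E h) \<le> E exp (h - h')\<close>, and \<open>h - h'\<close> is symmetric.\<close>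
  have jensen: "exp (- (\<integral>y. h y \<partial>M)) \<le> (\<integral>y. exp (- h y) \<partial>M)"
    using jensens_inequality[where I = UNIV and X = "\<lambda>y. - h y" and q = exp] int_h int_exp' exp_convex
    by simp
  \<comment> \<open>The product is written with either order of the two copies; averaging the two
    forms yields \<open>cosh (h y - h y')\<close>.\<close>
  have prod_eq: "(\<integral>y. exp (h y) \<partial>M) * (\<integral>y. exp (- h y) \<partial>M)
      = (\<integral>y. (\<integral>y'. exp (h y - h y') \<partial>M) \<partial>M)"
    by (simp add: exp_diff exp_minus divide_inverse)
  have prod_eq': "(\<integral>y. exp (h y) \<partial>M) * (\<integral>y. exp (- h y) \<partial>M)
      = (\<integral>y. (\<integral>y'. exp (h y' - h y) \<partial>M) \<partial>M)"
    by (simp add: exp_diff exp_minus divide_inverse)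
  have int2: "integrable (M \<Otimes>\<^sub>M M) (\<lambda>(y, y'). exp (h y - h y'))"
  proof (rule MM.P.integrable_const_bound[where B = "exp (2 * B)"])
    show "AE p in M \<Otimes>\<^sub>M M. norm (case p of (y, y') \<Rightarrow> exp (h y - h y')) \<le> exp (2 * B)"
    proof (rule AE_I2)
      fix p assume "p \<in> space (M \<Otimes>\<^sub>M M)"
      then show "norm (case p of (y, y') \<Rightarrow> exp (h y - h y')) \<le> exp (2 * B)"
        using h_bound[of "fst p"] h_bound[of "snd p"] by (auto simp: space_pair_measure)
    qed
  qed simp
  have int2': "integrable (M \<Otimes>\<^sub>M M) (\<lambda>(y, y'). exp (h y' - h y))"
  proof (rule MM.P.integrable_const_bound[where B = "exp (2 * B)"])
    show "AE p in M \<Otimes>\<^sub>M M. norm (case p of (y, y') \<Rightarrow> exp (h y' - h y)) \<le> exp (2 * B)"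
    proof (rule AE_I2)
      fix p assume "p \<in> space (M \<Otimes>\<^sub>M M)"
      then show "norm (case p of (y, y') \<Rightarrow> exp (h y' - h y)) \<le> exp (2 * B)"
        using h_bound[of "fst p"] h_bound[of "snd p"] by (auto simp: space_pair_measure)
    qed
  qed simp
  have int_W: "integrable (M \<Otimes>\<^sub>M M) (\<lambda>p. cosh (W p))"
  proof (rule MM.P.integrable_const_bound[where B = "cosh B'"])
    show "AE p in M \<Otimes>\<^sub>M M. norm (cosh (W p)) \<le> cosh B'"
    proof (rule AE_I2)
      fix p assume "p \<in> space (M \<Otimes>\<^sub>M M)"
      then show "norm (cosh (W p)) \<le> cosh B'"
        using W_bound[of p] cosh_real_nonneg_le_iff[of "\<bar>W p\<bar>" B'] by auto
    qed
    have "cosh \<in> borel_measurable (borel :: real measure)"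
      by (intro borel_measurable_continuous_onI continuous_intros)
    then show "(\<lambda>p. cosh (W p)) \<in> borel_measurable (M \<Otimes>\<^sub>M M)" by measurable
  qed
  have "(\<integral>y. exp (h y) \<partial>M) * exp (- (\<integral>y. h y \<partial>M))
      \<le> (\<integral>y. exp (h y) \<partial>M) * (\<integral>y. exp (- h y) \<partial>M)"
    by (intro mult_left_mono jensen integral_nonneg) auto
  also have "\<dots> = ((\<integral>p. (case p of (y, y') \<Rightarrow> exp (h y - h y')) \<partial>(M \<Otimes>\<^sub>M M))
      + (\<integral>p. (case p of (y, y') \<Rightarrow> exp (h y' - h y)) \<partial>(M \<Otimes>\<^sub>M M))) / 2"
    using prod_eq prod_eq' MM.integral_fst'[OF int2] MM.integral_fst'[OF int2'] by simp
  also have "\<dots> = (\<integral>p. (case p of (y, y') \<Rightarrow> cosh (h y - h y')) \<partial>(M \<Otimes>\<^sub>M M))"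
    using int2 int2'
    by (subst Bochner_Integration.integral_add[symmetric])
       (auto simp: cosh_def case_prod_beta simp flip: integral_divide_zero intro!: Bochner_Integration.integral_cong)
  also have "\<dots> \<le> (\<integral>p. cosh (W p) \<partial>(M \<Otimes>\<^sub>M M))"
  proof (rule integral_mono_AE')
    show "integrable (M \<Otimes>\<^sub>M M) (\<lambda>p. cosh (W p))" by (fact int_W)
    have "cosh (h y - h y') \<le> cosh (W (y, y'))" if "y \<in> space M" "y' \<in> space M" for y y'
      using h_W[OF that] cosh_real_nonneg_le_iff[of "\<bar>h y - h y'\<bar>" "W (y, y')"] by auto
    then show "AE p in M \<Otimes>\<^sub>M M. (case p of (y, y') \<Rightarrow> cosh (h y - h y')) \<le> cosh (W p)"
      by (intro AE_I2) (auto simp: space_pair_measure)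
  qed auto
  finally show ?thesis
    by (simp add: exp_minus field_simps)
qed

lemma exp_integral_PiM_bounded_differences:
  fixes N :: "'b measure" and f :: "('i \<Rightarrow> 'b) \<Rightarrow> real" and W :: "'i \<Rightarrow> 'b \<times> 'b \<Rightarrow> real"
  assumes "prob_space N" "finite J"
    and W_meas: "\<And>j. j \<in> J \<Longrightarrow> W j \<in> borel_measurable (N \<Otimes>\<^sub>M N)"
    and W_bound: "\<And>j p. j \<in> J \<Longrightarrow> p \<in> space (N \<Otimes>\<^sub>M N) \<Longrightarrow> \<bar>W j p\<bar> \<le> B'"
    and "f \<in> borel_measurable (PiM J (\<lambda>_. N))"
    and "\<And>z. z \<in> space (PiM J (\<lambda>_. N)) \<Longrightarrow> \<bar>f z\<bar> \<le> B"
    and "\<And>j z y y'. j \<in> J \<Longrightarrow> z \<in> space (PiM J (\<lambda>_. N)) \<Longrightarrow> y \<in> space N \<Longrightarrow> y' \<in> space N \<Longrightarrow>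
           \<bar>f (z(j := y)) - f (z(j := y'))\<bar> \<le> W j (y, y')"
  shows "(\<integral>z. exp (f z) \<partial>PiM J (\<lambda>_. N))
    \<le> exp (\<integral>z. f z \<partial>PiM J (\<lambda>_. N)) * (\<Prod>j\<in>J. \<integral>p. cosh (W j p) \<partial>(N \<Otimes>\<^sub>M N))"
  using assms(2-)
proof (induction J arbitrary: f rule: finite_induct)
  case empty
  then show ?case by (simp add: PiM_empty lebesgue_integral_count_space_finite)
next
  case (insert i I f)
  interpret N: prob_space N by fact
  interpret product_prob_space "\<lambda>_::'i. N" ..
  let ?P = "PiM I (\<lambda>_. N)" and ?Q = "PiM (insert i I) (\<lambda>_. N)"
  interpret PI: prob_space ?P by (rule prob_space_PiM) (rule assms(1))
  interpret PQ: prob_space ?Q by (rule prob_space_PiM) (rule assms(1))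
  note [measurable] = insert.prems(3)
  have upd: "x(i := y) \<in> space ?Q" if "x \<in> space ?P" "y \<in> space N" for x y
    using that by (auto simp: space_PiM PiE_def extensional_def)
  have fm[measurable]: "(\<lambda>(x, y). f (x(i := y))) \<in> borel_measurable (?P \<Otimes>\<^sub>M N)"
    using measurable_compose[OF measurable_add_dim insert.prems(3)] by (simp add: case_prod_beta')
  \<comment> \<open>\<open>h\<close> is the conditional mean of \<open>f\<close> given the
    coordinates in \<open>I\<close>. Averaging preserves the bound \<open>B\<close> and the
    difference bounds \<open>W j\<close>, so the induction hypothesis applies to
    \<open>h\<close>.\<close>
  define h where "h x = (\<integral>y. f (x(i := y)) \<partial>N)" for x
  have [measurable]: "h \<in> borel_measurable ?P"
    unfolding h_def by measurable
  have fx[measurable]: "(\<lambda>y. f (x(i := y))) \<in> borel_measurable N" if "x \<in> space ?P" for x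
    using measurable_Pair2[OF fm that] by simp
  have int_fx: "integrable N (\<lambda>y. f (x(i := y)))" if "x \<in> space ?P" for x
    by (rule N.integrable_const_bound[where B = B]) (use insert.prems(4) upd that in auto)
  have h_le: "\<bar>h x\<bar> \<le> B" if "x \<in> space ?P" for x
  proof -
    have "\<bar>h x\<bar> \<le> (\<integral>y. \<bar>f (x(i := y))\<bar> \<partial>N)"
      unfolding h_def by (rule integral_abs_bound)
    also have "\<dots> \<le> (\<integral>y. B \<partial>N)"
      by (intro integral_mono integrable_abs int_fx that) (use insert.prems(4) upd that in auto)
    finally show ?thesis by (simp add: N.prob_space)
  qed
  have h_diff: "\<bar>h (z(j := y)) - h (z(j := y'))\<bar> \<le> W j (y, y')"
    if "j \<in> I" "z \<in> space ?P" "y \<in> space N" "y' \<in> space N" for j z y y'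
  proof -
    have zy: "z(j := y) \<in> space ?P" "z(j := y') \<in> space ?P"
      using that by (auto simp: space_PiM PiE_def extensional_def)
    have "\<bar>h (z(j := y)) - h (z(j := y'))\<bar>
        = \<bar>\<integral>t. f (z(j := y, i := t)) - f (z(j := y', i := t)) \<partial>N\<bar>"
      unfolding h_def using int_fx zy by simp
    also have "\<dots> \<le> (\<integral>t. \<bar>f (z(j := y, i := t)) - f (z(j := y', i := t))\<bar> \<partial>N)"
      by (rule integral_abs_bound)
    also have "\<dots> \<le> (\<integral>t. W j (y, y') \<partial>N)"
    proof (intro integral_mono)
      fix t assume t: "t \<in> space N"
      have "i \<noteq> j" using that insert.hyps by auto
      then have "z(j := y, i := t) = z(i := t, j := y)" "z(j := y', i := t) = z(i := t, j := y')"
        by (auto simp: fun_upd_twist)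
      moreover have "\<bar>f (z(i := t, j := y)) - f (z(i := t, j := y'))\<bar> \<le> W j (y, y')"
        by (rule insert.prems(5)) (use that upd t in blast)+
      ultimately show "\<bar>f (z(j := y, i := t)) - f (z(j := y', i := t))\<bar> \<le> W j (y, y')"
        by (simp only:)
    qed (use int_fx zy in auto)
    finally show ?thesis by (simp add: N.prob_space)
  qed
  have IH: "(\<integral>x. exp (h x) \<partial>?P) \<le> exp (\<integral>x. h x \<partial>?P) * (\<Prod>j\<in>I. \<integral>p. cosh (W j p) \<partial>(N \<Otimes>\<^sub>M N))"
  proof (rule insert.IH)
    show "W j \<in> borel_measurable (N \<Otimes>\<^sub>M N)" if "j \<in> I" for j
      using insert.prems(1) that by blast
    show "\<bar>W j p\<bar> \<le> B'" if "j \<in> I" "p \<in> space (N \<Otimes>\<^sub>M N)" for j p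
      using insert.prems(2) that by blast
    show "h \<in> borel_measurable ?P" by measurable
    show "\<bar>h z\<bar> \<le> B" if "z \<in> space ?P" for z using h_le[OF that] .
    show "\<bar>h (z(j := y)) - h (z(j := y'))\<bar> \<le> W j (y, y')"
      if "j \<in> I" "z \<in> space ?P" "y \<in> space N" "y' \<in> space N" for j z y y'
      using h_diff[OF that] .
  qed
  let ?c = "\<integral>p. cosh (W i p) \<partial>(N \<Otimes>\<^sub>M N)"
  have inner: "(\<integral>y. exp (f (x(i := y))) \<partial>N) \<le> exp (h x) * ?c" if x: "x \<in> space ?P" for x
    unfolding h_def
  proof (rule N.exp_integral_symmetrization[where B = B and B' = B'])
    show "\<bar>f (x(i := y))\<bar> \<le> B" if "y \<in> space N" for y
      using insert.prems(4) upd x that by blast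
    show "\<bar>W i p\<bar> \<le> B'" if "p \<in> space (N \<Otimes>\<^sub>M N)" for p
      using insert.prems(2) that by blast
    show "W i \<in> borel_measurable (N \<Otimes>\<^sub>M N)"
      using insert.prems(1) by blast
    show "\<bar>f (x(i := y)) - f (x(i := y'))\<bar> \<le> W i (y, y')" if "y \<in> space N" "y' \<in> space N" for y y'
      using insert.prems(5)[OF insertI1 upd[OF x that(1)] that] by (simp only: fun_upd_upd)
  qed (rule fx[OF x])
  have "(\<integral>z. exp (f z) \<partial>?Q) = (\<integral>x. (\<integral>y. exp (f (x(i := y))) \<partial>N) \<partial>?P)"
  proof (rule product_integral_insert)
    show "integrable ?Q (\<lambda>z. exp (f z))"
    proof (rule PQ.integrable_const_bound)
      show "AE z in ?Q. norm (exp (f z)) \<le> exp B"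
        using insert.prems(4) by (intro AE_I2) (simp add: abs_le_iff)
    qed measurable
  qed (fact insert.hyps)+
  also have "\<dots> \<le> (\<integral>x. exp (h x) * ?c \<partial>?P)"
  proof (rule integral_mono_AE')
    show "integrable ?P (\<lambda>x. exp (h x) * ?c)"
      by (intro integrable_mult_left PI.integrable_const_bound[where B = "exp B"] AE_I2)
         (use h_le in \<open>auto simp: abs_le_iff\<close>)
  qed (use inner in \<open>auto intro!: AE_I2 integral_nonneg\<close>)
  also have "\<dots> = (\<integral>x. exp (h x) \<partial>?P) * ?c" by simp
  also have "\<dots> \<le> exp (\<integral>x. h x \<partial>?P) * (\<Prod>j\<in>I. \<integral>p. cosh (W j p) \<partial>(N \<Otimes>\<^sub>M N)) * ?c"
    by (intro mult_right_mono IH integral_nonneg) auto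
  also have "(\<integral>x. h x \<partial>?P) = (\<integral>z. f z \<partial>?Q)"
    unfolding h_def
  proof (rule product_integral_insert[symmetric])
    show "integrable ?Q f"
    proof (rule PQ.integrable_const_bound)
      show "AE z in ?Q. norm (f z) \<le> B"
        using insert.prems(4) by (intro AE_I2) simp
    qed measurable
  qed (fact insert.hyps)+
  finally show ?case using insert.hyps by (simp add: mult_ac)
qed

section \<open>Moments and cosh sums of clipped coefficients\<close>

text \<open>Jensen's inequality for the function \<open>x ^ q\<close>, convex on the nonnegative
  reals, at the points \<open>b i / w i\<close> with the normalized weights
  \<open>w i / s\<close>.\<close>

lemma power_sum_le_weighted:
  fixes w b :: "'i \<Rightarrow> real"
  assumes "finite I" and w: "\<And>i. i \<in> I \<Longrightarrow> 0 < w i" and b: "\<And>i. i \<in> I \<Longrightarrow> 0 \<le> b i" and q: "q \<ge> 1"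
  shows "(\<Sum>i\<in>I. b i) ^ q \<le> (\<Sum>i\<in>I. w i) ^ (q - 1) * (\<Sum>i\<in>I. b i ^ q / w i ^ (q - 1))"
proof (cases "I = {}")
  case True
  then show ?thesis using q by (simp add: power_0_left)
next
  case False
  define s where "s = (\<Sum>i\<in>I. w i)"
  have s: "0 < s" unfolding s_def using assms False by (intro sum_pos) auto
  have conv: "convex_on {0::real..} (\<lambda>x. x ^ q)"
    using convex_power_odd convex_on_subset[OF convex_power_even] by (cases "even q") auto
  have "(\<Sum>i\<in>I. w i / s) = 1"
    using s by (simp add: s_def flip: sum_divide_distrib)
  then have "(\<Sum>i\<in>I. (w i / s) *\<^sub>R (b i / w i)) ^ q \<le> (\<Sum>i\<in>I. (w i / s) * (b i / w i) ^ q)"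
    using w b s by (intro convex_on_sum[OF \<open>finite I\<close> False conv]) (auto simp: less_imp_le)
  moreover have "(\<Sum>i\<in>I. (w i / s) *\<^sub>R (b i / w i)) = (\<Sum>i\<in>I. b i) / s"
    unfolding sum_divide_distrib using w s by (intro sum.cong) (auto simp: less_imp_neq[THEN not_sym])
  moreover have "(\<Sum>i\<in>I. (w i / s) * (b i / w i) ^ q) = (\<Sum>i\<in>I. b i ^ q / w i ^ (q - 1)) / s"
    unfolding sum_divide_distrib using q
  proof (intro sum.cong refl)
    fix i assume "i \<in> I"
    then have "w i \<noteq> 0" using w[of i] by simp
    then show "(w i / s) * (b i / w i) ^ q = b i ^ q / w i ^ (q - 1) / s"
      using q by (cases q) (auto simp: power_divide)
  qed
  ultimately have "(\<Sum>i\<in>I. b i) ^ q / s ^ q \<le> (\<Sum>i\<in>I. b i ^ q / w i ^ (q - 1)) / s"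
    by (simp add: power_divide)
  then have "(\<Sum>i\<in>I. b i) ^ q \<le> (\<Sum>i\<in>I. b i ^ q / w i ^ (q - 1)) / s * s ^ q"
    using s by (simp add: field_simps)
  also have "\<dots> = s ^ (q - 1) * (\<Sum>i\<in>I. b i ^ q / w i ^ (q - 1))"
    using q s by (cases q) auto
  finally show ?thesis by (simp add: s_def)
qed

lemma sum_power_inj_le:
  fixes r :: real
  assumes "finite T" "inj_on h T" "0 \<le> r" "r < 1"
  shows "(\<Sum>t\<in>T. r ^ h t) \<le> 1 / (1 - r)"
proof -
  have "(\<Sum>t\<in>T. r ^ h t) = (\<Sum>k\<in>h ` T. r ^ k)"
    using assms by (simp add: sum.reindex)
  also have "\<dots> \<le> (\<Sum>k. r ^ k)"
    using assms by (intro sum_le_suminf summable_geometric) auto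
  also have "\<dots> = 1 / (1 - r)"
    using assms by (intro suminf_geometric) auto
  finally show ?thesis .
qed

text \<open>The weights \<open>r ^ (i - m)\<close> are used twice. As Jensen weights in
  \<open>i\<close> they sum to at most \<open>Z = 1 / (1 - r)\<close> and contribute
  \<open>Z ^ (q - 1)\<close>. The decay \<open>(r ^ (i - m)) ^ q\<close> of the coefficients leaves
  one power of the weight over after the division by \<open>w ^ (q - 1)\<close>, and summing it over
  \<open>m\<close> contributes the last factor \<open>Z\<close>.\<close>

lemma sum_power_clipped_le:
  fixes c :: "int \<Rightarrow> int \<Rightarrow> 'p::finite \<Rightarrow> real"
  assumes fin: "finite I" "finite T" and q: "q \<ge> 2" and r: "0 < r" "r < 1" and a: "0 \<le> a" and d: "0 \<le> d"
    and c0: "\<And>i m j. 0 \<le> c i m j" and c1: "\<And>i m j. i < m \<Longrightarrow> c i m j = 0"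
    and c2: "\<And>i m. m \<le> i \<Longrightarrow> (\<Sum>j\<in>UNIV. (c i m j)\<^sup>2) \<le> C * (r ^ nat (i - m)) ^ q"
  shows "(\<Sum>m\<in>T. \<Sum>j\<in>UNIV. (\<Sum>i\<in>I. min a (c i m j * d)) ^ q)
    \<le> real (card I) * d\<^sup>2 * C * a ^ (q - 2) * (1 / (1 - r)) ^ q"
proof -
  define Z where "Z = 1 / (1 - r)"
  define b where "b i m j = min a (c i m j * d)" for i m j
  define w where "w i m = r ^ nat (i - m)" for i m :: int
  have w: "0 < w i m" for i m using r by (simp add: w_def)
  have Z: "0 \<le> Z" using r by (simp add: Z_def)
  have b0: "0 \<le> b i m j" for i m j using a d c0 by (simp add: b_def)
  \<comment> \<open>Two of the \<open>q\<close> factors are bounded by \<open>c i m j * d\<close>,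
    the other \<open>q - 2\<close> by the cap \<open>a\<close>; the squares are what
    \<open>c2\<close> sums over \<open>j\<close>.\<close>
  have bq: "b i m j ^ q \<le> a ^ (q - 2) * d\<^sup>2 * (c i m j)\<^sup>2" for i m j
  proof -
    have "b i m j ^ q = b i m j ^ (q - 2) * (b i m j)\<^sup>2"
      using q by (metis le_add_diff_inverse2 power_add)
    also have "\<dots> \<le> a ^ (q - 2) * (c i m j * d)\<^sup>2"
      using b0[of i m j] a by (intro mult_mono power_mono) (auto simp: b_def)
    finally show ?thesis by (simp add: power_mult_distrib mult_ac)
  qed
  have wI: "(\<Sum>i\<in>{i\<in>I. m \<le> i}. w i m) \<le> Z" for m
    unfolding w_def Z_def using fin r by (intro sum_power_inj_le) (auto simp: inj_on_def)
  have wT: "(\<Sum>m\<in>{m\<in>T. m \<le> i}. w i m) \<le> Z" for i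
    unfolding w_def Z_def using fin r by (intro sum_power_inj_le) (auto simp: inj_on_def)
  have C0: "0 \<le> C"
  proof -
    have "0 \<le> (\<Sum>j\<in>UNIV. (c 0 0 j)\<^sup>2)" by (intro sum_nonneg) auto
    also have "\<dots> \<le> C" using c2[of 0 0] by simp
    finally show ?thesis .
  qed
  have step: "(\<Sum>i\<in>I. b i m j) ^ q
      \<le> Z ^ (q - 1) * (\<Sum>i\<in>{i\<in>I. m \<le> i}. b i m j ^ q / w i m ^ (q - 1))" for m j
  proof -
    have "(\<Sum>i\<in>I. b i m j) = (\<Sum>i\<in>{i\<in>I. m \<le> i}. b i m j)"
      using fin c1 a by (intro sum.mono_neutral_right) (auto simp: b_def not_le)
    also have "(\<Sum>i\<in>{i\<in>I. m \<le> i}. b i m j) ^ q \<le> (\<Sum>i\<in>{i\<in>I. m \<le> i}. w i m) ^ (q - 1)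
        * (\<Sum>i\<in>{i\<in>I. m \<le> i}. b i m j ^ q / w i m ^ (q - 1))"
      using fin w b0 q by (intro power_sum_le_weighted) auto
    also have "\<dots> \<le> Z ^ (q - 1) * (\<Sum>i\<in>{i\<in>I. m \<le> i}. b i m j ^ q / w i m ^ (q - 1))"
      using w b0 by (intro mult_right_mono power_mono wI sum_nonneg divide_nonneg_nonneg)
        (auto simp: less_imp_le)
    finally show ?thesis .
  qed
  have col: "(\<Sum>j\<in>UNIV. b i m j ^ q / w i m ^ (q - 1)) \<le> a ^ (q - 2) * d\<^sup>2 * C * w i m"
    if "m \<le> i" for i m
  proof -
    have "(\<Sum>j\<in>UNIV. b i m j ^ q) \<le> (\<Sum>j\<in>UNIV. a ^ (q - 2) * d\<^sup>2 * (c i m j)\<^sup>2)"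
      by (intro sum_mono bq)
    also have "\<dots> \<le> a ^ (q - 2) * d\<^sup>2 * (C * w i m ^ q)"
      unfolding sum_distrib_left[symmetric] using c2[OF that] a d
      by (intro mult_left_mono) (auto simp: w_def)
    finally have "(\<Sum>j\<in>UNIV. b i m j ^ q) / w i m ^ (q - 1) \<le> a ^ (q - 2) * d\<^sup>2 * (C * w i m ^ q) / w i m ^ (q - 1)"
      using w by (intro divide_right_mono) (auto simp: less_imp_le)
    also have "\<dots> = a ^ (q - 2) * d\<^sup>2 * C * w i m"
      using q w[of i m] by (cases q) auto
    finally show ?thesis by (simp add: sum_divide_distrib)
  qed
  have "(\<Sum>m\<in>T. \<Sum>j\<in>UNIV. (\<Sum>i\<in>I. b i m j) ^ q)
      \<le> (\<Sum>m\<in>T. \<Sum>j\<in>UNIV. Z ^ (q - 1) * (\<Sum>i\<in>{i\<in>I. m \<le> i}. b i m j ^ q / w i m ^ (q - 1)))"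
    by (intro sum_mono step)
  also have "\<dots> = Z ^ (q - 1) * (\<Sum>m\<in>T. \<Sum>i\<in>{i\<in>I. m \<le> i}. \<Sum>j\<in>UNIV. b i m j ^ q / w i m ^ (q - 1))"
    unfolding sum_distrib_left[symmetric] by (subst sum.swap) (rule refl)
  also have "\<dots> \<le> Z ^ (q - 1) * (\<Sum>m\<in>T. \<Sum>i\<in>{i\<in>I. m \<le> i}. a ^ (q - 2) * d\<^sup>2 * C * w i m)"
    using Z by (intro mult_left_mono sum_mono col) auto
  \<comment> \<open>After the exchange of the sums the leftover weight is summed over
    \<open>m\<close> for fixed \<open>i\<close>, which is again part of a geometric series.\<close>
  also have "\<dots> = Z ^ (q - 1) * (a ^ (q - 2) * d\<^sup>2 * C * (\<Sum>i\<in>I. \<Sum>m\<in>{m\<in>T. m \<le> i}. w i m))"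
    using sum.swap_restrict[OF fin(2) fin(1), of "\<lambda>m i. w i m" "\<lambda>m i. m \<le> i"]
    by (simp flip: sum_distrib_left)
  also have "\<dots> \<le> Z ^ (q - 1) * (a ^ (q - 2) * d\<^sup>2 * C * (\<Sum>i\<in>I. Z))"
    using Z a C0 by (intro mult_left_mono sum_mono wT) auto
  also have "\<dots> = real (card I) * d\<^sup>2 * C * a ^ (q - 2) * Z ^ q"
    using q by (cases q) auto
  finally show ?thesis by (simp add: b_def Z_def)
qed

text \<open>With \<open>t = 2 L / (\<tau> q)\<close> the base is \<open>exp (- t)\<close>, and
  \<open>1 - exp (- t) \<ge> t * exp (- t)\<close> bounds the left side by
  \<open>exp (q t) / (t ^ q * fact q)\<close>. The factor \<open>q ^ q\<close> contained in
  \<open>1 / t ^ q\<close> is absorbed by \<open>fact q\<close> at the price of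
  \<open>exp 1 ^ q\<close>, which is why the bound is geometric in \<open>q\<close>.\<close>

lemma geometric_factor_le:
  fixes \<rho> \<tau> :: real
  assumes \<rho>: "0 < \<rho>" "\<rho> < 1" and \<tau>: "1 \<le> \<tau>" and q: "q \<ge> 1"
  shows "(1 / (1 - \<rho> powr (2 / (\<tau> * real q)))) ^ q / fact q
    \<le> (exp 1 * \<tau> / (2 * ln (1 / \<rho>))) ^ q / \<rho>\<^sup>2"
proof -
  define L where "L = ln (1 / \<rho>)"
  define t where "t = 2 * L / (\<tau> * real q)"
  have L: "0 < L" using \<rho> by (simp add: L_def)
  have t: "0 < t" using L \<tau> q by (simp add: t_def)
  have r: "\<rho> powr (2 / (\<tau> * real q)) = exp (- t)"
    using \<rho> by (simp add: powr_def t_def L_def ln_div)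
  have "t * exp (- t) \<le> 1 - exp (- t)"
    using exp_ge_add_one_self[of t] by (simp add: exp_minus field_simps)
  moreover have "0 < t * exp (- t)" using t by simp
  ultimately have "1 / (1 - exp (- t)) \<le> 1 / (t * exp (- t))"
    using t by (intro divide_left_mono mult_pos_pos) auto
  then have "(1 / (1 - exp (- t))) ^ q \<le> (1 / (t * exp (- t))) ^ q"
    using t by (intro power_mono) auto
  also have "\<dots> = exp (real q * t) / t ^ q"
    by (simp add: power_divide power_mult_distrib exp_minus exp_of_nat2_mult field_simps)
  \<comment> \<open>Here \<open>q t = 2 L / \<tau>\<close>, and \<open>\<tau> \<ge> 1\<close>; the
    resulting factor is the same for all \<open>q\<close>.\<close>
  also have "exp (real q * t) \<le> 1 / \<rho>\<^sup>2"
  proof -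
    have "real q * t \<le> 2 * L"
      using \<tau> q L by (simp add: t_def field_simps)
    then have "exp (real q * t) \<le> exp (2 * L)" by simp
    also have "\<dots> = (exp L)\<^sup>2" by (simp add: exp_double)
    also have "\<dots> = 1 / \<rho>\<^sup>2" using \<rho> by (simp add: L_def power_divide)
    finally show ?thesis .
  qed
  finally have *: "(1 / (1 - exp (- t))) ^ q \<le> 1 / \<rho>\<^sup>2 / t ^ q"
    using t by (simp add: divide_right_mono)
  \<comment> \<open>The left side is a single term of the exponential series at
    \<open>q\<close>.\<close>
  have "real q ^ q / fact q \<le> exp (real q)"
  proof -
    have sm: "(\<lambda>k. real q ^ k / fact k) sums exp (real q)"
      using exp_converges[of "real q"] by (simp add: divide_inverse mult.commute)
    have "(\<Sum>k\<in>{q}. real q ^ k / fact k) \<le> (\<Sum>k. real q ^ k / fact k)"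
      using sums_summable[OF sm] by (intro sum_le_suminf) auto
    then show ?thesis using sums_unique[OF sm] by simp
  qed
  then have qq: "real q ^ q / fact q \<le> exp 1 ^ q" by (simp flip: exp_of_nat_mult)
  have "(1 / (1 - exp (- t))) ^ q / fact q \<le> 1 / \<rho>\<^sup>2 / t ^ q / fact q"
    using * by (intro divide_right_mono) auto
  also have "\<dots> = (real q ^ q / fact q) * ((\<tau> / (2 * L)) ^ q / \<rho>\<^sup>2)"
    by (simp add: t_def power_divide power_mult_distrib mult_ac)
  also have "\<dots> \<le> exp 1 ^ q * ((\<tau> / (2 * L)) ^ q / \<rho>\<^sup>2)"
    using qq \<tau> L by (intro mult_right_mono) auto
  also have "\<dots> = (exp 1 * \<tau> / (2 * L)) ^ q / \<rho>\<^sup>2"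
    by (simp add: power_divide power_mult_distrib)
  finally show ?thesis by (simp add: r L_def)
qed

text \<open>The expansion of \<open>cosh x - 1\<close> starts at the second power, and the moment
  hypothesis dominates it term by term by a geometric series with ratio
  \<open>l * \<beta>\<close>.\<close>

lemma sum_cosh_le_of_moments:
  fixes W :: "'s \<Rightarrow> real"
  assumes mom: "\<And>q. q \<ge> 2 \<Longrightarrow> (\<Sum>s\<in>S. W s ^ q) / fact q \<le> \<kappa> * \<beta> ^ (q - 2)"
    and W: "\<And>s. 0 \<le> W s" and \<kappa>: "0 \<le> \<kappa>" and \<beta>: "0 \<le> \<beta>" and l: "0 \<le> l" "l * \<beta> < 1"
  shows "(\<Sum>s\<in>S. cosh (l * W s) - 1) \<le> \<kappa> * l\<^sup>2 / (1 - l * \<beta>)"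
proof -
  \<comment> \<open>The \<open>cosh\<close> series shifted by two: the coefficients 1 and 0 of the
    first two powers are split off, and the shift keeps the parity test.\<close>
  define u where "u x k = (if even k then x ^ (k + 2) /\<^sub>R fact (k + 2) else 0)" for x :: real and k :: nat
  have u: "u x sums (cosh x - 1)" for x
  proof -
    have "(\<lambda>n. if even n then x ^ n /\<^sub>R fact n else 0) sums cosh x" by (rule cosh_converges)
    moreover have "(\<Sum>n<2. if even n then x ^ n /\<^sub>R fact n else 0) = 1"
      by (simp add: numeral_2_eq_2)
    ultimately show ?thesis
      using sums_split_initial_segment[of "\<lambda>n. if even n then x ^ n /\<^sub>R fact n else 0" "cosh x" 2]
      by (simp add: u_def[abs_def] del: fact_Suc power_Suc)
  qed
  have sums: "(\<lambda>k. \<Sum>s\<in>S. u (l * W s) k) sums (\<Sum>s\<in>S. cosh (l * W s) - 1)"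
    by (intro sums_sum u)
  have geo: "(\<lambda>k. \<kappa> * l\<^sup>2 * (l * \<beta>) ^ k) sums (\<kappa> * l\<^sup>2 * (1 / (1 - l * \<beta>)))"
    using l \<beta> by (intro sums_mult geometric_sums) auto
  have "(\<Sum>s\<in>S. u (l * W s) k) \<le> \<kappa> * l\<^sup>2 * (l * \<beta>) ^ k" for k
  proof -
    \<comment> \<open>Odd powers are included on the right; they are nonnegative, so this only
      enlarges the sum.\<close>
    have "(\<Sum>s\<in>S. u (l * W s) k) \<le> (\<Sum>s\<in>S. (l * W s) ^ (k + 2) / fact (k + 2))"
      using l W by (intro sum_mono) (auto simp: u_def field_simps simp del: fact_Suc power_Suc)
    also have "\<dots> = l ^ (k + 2) * ((\<Sum>s\<in>S. W s ^ (k + 2)) / fact (k + 2))"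
      by (simp add: sum_distrib_left sum_divide_distrib power_mult_distrib mult_ac del: fact_Suc power_Suc)
    also have "\<dots> \<le> l ^ (k + 2) * (\<kappa> * \<beta> ^ k)"
      using mom[of "k + 2"] l by (intro mult_left_mono) auto
    also have "\<dots> = \<kappa> * l\<^sup>2 * (l * \<beta>) ^ k"
      by (simp add: power_add power_mult_distrib power2_eq_square mult_ac)
    finally show ?thesis .
  qed
  from sums_le[OF this sums geo] show ?thesis by simp
qed

lemma weighted_column_norm_le_onorm:
  fixes A :: "real ^ 'p ^ 'm" and g :: "real ^ 'm"
  assumes g: "\<And>l. 0 \<le> g $ l" "(\<Sum>l\<in>UNIV. g $ l) = 1"
  shows "(\<Sum>j\<in>UNIV. (\<Sum>l\<in>UNIV. g $ l * \<bar>A $ l $ j\<bar>)\<^sup>2) \<le> (onorm ((*v) A))\<^sup>2"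
proof -
  have row: "(\<Sum>j\<in>UNIV. (A $ l $ j)\<^sup>2) \<le> (onorm ((*v) A))\<^sup>2" for l
  proof -
    have n2: "(norm (A $ l))\<^sup>2 = (A *v (A $ l)) $ l"
      by (simp add: matrix_vector_mul_component power2_norm_eq_inner)
    also have "\<dots> \<le> norm (A *v (A $ l))"
      using component_le_norm_cart[of "A *v (A $ l)" l] by simp
    also have "\<dots> \<le> onorm ((*v) A) * norm (A $ l)"
      by (rule onorm) (rule matrix_vector_mul_bounded_linear)
    finally have "norm (A $ l) \<le> onorm ((*v) A)"
      by (cases "norm (A $ l) = 0") (auto simp: power2_eq_square onorm_pos_le matrix_vector_mul_bounded_linear)
    then have "(norm (A $ l))\<^sup>2 \<le> (onorm ((*v) A))\<^sup>2"
      by (intro power_mono) auto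
    then show ?thesis
      by (simp add: norm_vec_def L2_set_def sum_nonneg)
  qed
  have "(\<Sum>l\<in>UNIV. g $ l * \<bar>A $ l $ j\<bar>)\<^sup>2 \<le> (\<Sum>l\<in>UNIV. g $ l * (A $ l $ j)\<^sup>2)" for j
    using convex_on_sum[OF _ _ convex_power2, of "UNIV :: 'm set" "\<lambda>l. g $ l" "\<lambda>l. \<bar>A $ l $ j\<bar>"] g by simp
  then have "(\<Sum>j\<in>UNIV. (\<Sum>l\<in>UNIV. g $ l * \<bar>A $ l $ j\<bar>)\<^sup>2)
      \<le> (\<Sum>j\<in>UNIV. \<Sum>l\<in>UNIV. g $ l * (A $ l $ j)\<^sup>2)"
    by (intro sum_mono)
  also have "\<dots> = (\<Sum>l\<in>UNIV. g $ l * (\<Sum>j\<in>UNIV. (A $ l $ j)\<^sup>2))"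
    unfolding sum_distrib_left by (rule sum.swap)
  also have "\<dots> \<le> (\<Sum>l\<in>UNIV. g $ l * (onorm ((*v) A))\<^sup>2)"
    by (intro sum_mono mult_left_mono row g)
  also have "\<dots> = (onorm ((*v) A))\<^sup>2"
    using g(2) by (simp flip: sum_distrib_right)
  finally show ?thesis .
qed

text \<open>The moment bound is applied for each \<open>q\<close> with its own \<open>r\<close>,
  chosen so that \<open>r ^ q = \<rho> powr (2 / \<tau>)\<close>; the squared norm bound is then
  exactly \<open>\<gamma> ^ 2 * (r ^ k) ^ q\<close>. The normalized moments grow like
  \<open>(2 * M * E) ^ (q - 2)\<close>, and \<open>2 * M * E\<close> is the constant in the
  hypothesis on \<open>lam\<close>.\<close>

lemma sum_cosh_clipped_le:
  fixes c :: "int \<Rightarrow> int \<Rightarrow> 'p::finite \<Rightarrow> real"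
  assumes fin: "finite I" "finite T" and \<rho>: "0 < \<rho>" "\<rho> < 1" and \<tau>: "1 \<le> \<tau>"
    and M: "0 \<le> M" and d: "0 \<le> d" and lam: "0 \<le> lam" "lam * (exp 1 * \<tau> * M / ln (1 / \<rho>)) < 1"
    and c0: "\<And>i m j. 0 \<le> c i m j" and c1: "\<And>i m j. i < m \<Longrightarrow> c i m j = 0"
    and c2: "\<And>i m. m \<le> i \<Longrightarrow> (\<Sum>j\<in>UNIV. (c i m j)\<^sup>2) \<le> (\<gamma> * \<rho> powr (real (nat (i - m)) / \<tau>))\<^sup>2"
  shows "(\<Sum>(m, j)\<in>T \<times> UNIV. cosh (lam * (\<Sum>i\<in>I. min (2 * M) (c i m j * d))) - 1)
    \<le> real (card I) * d\<^sup>2 * \<gamma>\<^sup>2 * (exp 1 * \<tau> / (2 * ln (1 / \<rho>)))\<^sup>2 / \<rho>\<^sup>2 * lam\<^sup>2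
        / (1 - lam * (exp 1 * \<tau> * M / ln (1 / \<rho>)))"
proof -
  define E where "E = exp 1 * \<tau> / (2 * ln (1 / \<rho>))"
  have EM: "exp 1 * \<tau> * M / ln (1 / \<rho>) = 2 * M * E" by (simp add: E_def)
  have L: "0 < ln (1 / \<rho>)" using \<rho> by simp
  then have E: "0 \<le> E" using \<tau> by (simp add: E_def)
  define W where "W s = (\<Sum>i\<in>I. min (2 * M) (c i (fst s) (snd s) * d))" for s
  define \<kappa> where "\<kappa> = real (card I) * d\<^sup>2 * \<gamma>\<^sup>2 * E\<^sup>2 / \<rho>\<^sup>2"
  have "(\<Sum>s\<in>T \<times> UNIV. cosh (lam * W s) - 1) \<le> \<kappa> * lam\<^sup>2 / (1 - lam * (2 * M * E))"
  proof (rule sum_cosh_le_of_moments)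
    fix q :: nat assume q: "q \<ge> 2"
    define r where "r = \<rho> powr (2 / (\<tau> * real q))"
    have r: "0 < r" "r < 1" using \<rho> \<tau> q powr_less_mono'[of \<rho> 0 "2 / (\<tau> * real q)"] by (auto simp: r_def)
    have rq: "(\<gamma> * \<rho> powr (real k / \<tau>))\<^sup>2 = \<gamma>\<^sup>2 * (r ^ k) ^ q" for k
    proof -
      have "(r ^ k) ^ q = r powr (real k * real q)"
        using r by (simp add: powr_realpow flip: power_mult of_nat_mult)
      also have "\<dots> = \<rho> powr (real k / \<tau> * 2)"
        using \<tau> q by (simp add: r_def powr_powr mult.commute)
      also have "\<dots> = (\<rho> powr (real k / \<tau>))\<^sup>2"
        using \<rho> by (simp add: powr_powr flip: powr_numeral)
      finally show ?thesis by (simp add: power_mult_distrib)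
    qed
    have "(\<Sum>s\<in>T \<times> UNIV. W s ^ q) = (\<Sum>m\<in>T. \<Sum>j\<in>UNIV. (\<Sum>i\<in>I. min (2 * M) (c i m j * d)) ^ q)"
      by (simp add: W_def sum.cartesian_product case_prod_beta')
    also have "\<dots> \<le> real (card I) * d\<^sup>2 * \<gamma>\<^sup>2 * (2 * M) ^ (q - 2) * (1 / (1 - r)) ^ q"
      by (intro sum_power_clipped_le fin q r d c0 c1 c2[unfolded rq]) (use M in auto)
    finally have "(\<Sum>s\<in>T \<times> UNIV. W s ^ q) / fact q
        \<le> real (card I) * d\<^sup>2 * \<gamma>\<^sup>2 * (2 * M) ^ (q - 2) * (1 / (1 - r)) ^ q / fact q"
      by (intro divide_right_mono) auto
    also have "\<dots> = real (card I) * d\<^sup>2 * \<gamma>\<^sup>2 * (2 * M) ^ (q - 2) * ((1 / (1 - r)) ^ q / fact q)"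
      by simp
    also have "\<dots> \<le> real (card I) * d\<^sup>2 * \<gamma>\<^sup>2 * (2 * M) ^ (q - 2) * (E ^ q / \<rho>\<^sup>2)"
      unfolding r_def E_def using M \<rho> \<tau> q by (intro mult_left_mono geometric_factor_le) auto
    also have "E ^ q = E ^ (q - 2) * E\<^sup>2" using q by (metis le_add_diff_inverse2 power_add)
    finally show "(\<Sum>s\<in>T \<times> UNIV. W s ^ q) / fact q \<le> \<kappa> * (2 * M * E) ^ (q - 2)"
      by (simp add: \<kappa>_def power_mult_distrib mult_ac)
  qed (use M E d lam c0 EM in \<open>auto simp: W_def \<kappa>_def intro!: sum_nonneg\<close>)
  then show ?thesis
    by (simp add: W_def \<kappa>_def EM case_prod_beta' flip: E_def)
qed

section \<open>Measurability, continuity and second moments\<close>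

lemma borel_measurable_vec_lambda:
  fixes f :: "'p::finite \<Rightarrow> 'a \<Rightarrow> real"
  assumes "\<And>j. f j \<in> borel_measurable M"
  shows "(\<lambda>x. \<chi> j. f j x) \<in> borel_measurable M"
  unfolding borel_measurable_euclidean_space[where f = "\<lambda>x. \<chi> j. f j x"] Basis_vec_def
  using assms by (auto simp: inner_axis)

lemma borel_measurable_matrix_vector_mult:
  fixes A :: "real ^ 'n ^ 'm"
  assumes "f \<in> borel_measurable M"
  shows "(\<lambda>x. A *v f x) \<in> borel_measurable M"
  using measurable_compose[OF assms, of "(*v) A" borel]
  by (simp add: borel_measurable_continuous_onI matrix_vector_mult_linear_continuous_on)

text \<open>Coordinate differences are at most the Euclidean distance, so the sum of
  \<open>g\<close> is a Lipschitz constant. Continuity serves both the measurability of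
  \<open>G\<close> and the limit of the truncated processes.\<close>

lemma continuous_on_weighted_l1_lipschitz:
  fixes G :: "real ^ 'p \<Rightarrow> real" and g :: "real ^ 'p::finite"
  assumes g: "\<And>l. 0 \<le> g $ l" and G: "\<And>u v. \<bar>G u - G v\<bar> \<le> (\<Sum>l\<in>UNIV. g $ l * \<bar>u $ l - v $ l\<bar>)"
  shows "continuous_on UNIV G"
proof -
  have "dist (G u) (G v) \<le> (\<Sum>l\<in>UNIV. g $ l) * dist u v" for u v
  proof -
    have "dist (G u) (G v) \<le> (\<Sum>l\<in>UNIV. g $ l * dist u v)"
    proof (unfold dist_real_def, rule order_trans[OF G], rule sum_mono, rule mult_left_mono)
      show "\<bar>u $ l - v $ l\<bar> \<le> dist u v" for l
        using component_le_norm_cart[of "u - v" l] by (simp add: dist_norm)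
    qed (rule g)
    then show ?thesis by (simp add: sum_distrib_right)
  qed
  then have "(\<Sum>l\<in>UNIV. g $ l)-lipschitz_on UNIV G"
    using g by (intro lipschitz_onI sum_nonneg) auto
  then show ?thesis by (rule lipschitz_on_continuous_on)
qed

text \<open>The zero mean removes the cross term. This is the source of the factor 2 in front of the
  variance in the exponential moment bound.\<close>

lemma square_difference_expectation:
  fixes N :: "real measure"
  assumes N: "prob_space N" and sets: "sets N = sets borel"
    and int: "integrable N (\<lambda>y. y)" "integrable N (\<lambda>y. y\<^sup>2)" and mean: "(\<integral>y. y \<partial>N) = 0"
  shows "integrable (N \<Otimes>\<^sub>M N) (\<lambda>(y, y'). (y - y')\<^sup>2)"
    and "(\<integral>(y, y'). (y - y')\<^sup>2 \<partial>(N \<Otimes>\<^sub>M N)) = 2 * (\<integral>y. y\<^sup>2 \<partial>N)"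
proof -
  interpret N: prob_space N by fact
  interpret NN: pair_prob_space N N ..
  note [measurable_cong] = sets
  have i1: "integrable (N \<Otimes>\<^sub>M N) (\<lambda>(y, y'). y\<^sup>2)"
  proof (rule NN.Fubini_integrable)
    show "integrable N (\<lambda>y. \<integral>y'. norm (case (y, y') of (y, y') \<Rightarrow> y\<^sup>2) \<partial>N)"
      using int(2) by (simp add: N.prob_space)
  qed auto
  have i2: "integrable (N \<Otimes>\<^sub>M N) (\<lambda>(y, y'). y'\<^sup>2)"
  proof (rule NN.Fubini_integrable)
    show "AE y in N. integrable N (\<lambda>y'. case (y, y') of (y, y') \<Rightarrow> y'\<^sup>2)"
      using int(2) by simp
  qed auto
  have i3: "integrable (N \<Otimes>\<^sub>M N) (\<lambda>(y, y'). y * y')"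
  proof (rule NN.Fubini_integrable)
    show "AE y in N. integrable N (\<lambda>y'. case (y, y') of (y, y') \<Rightarrow> y * y')"
      using int(1) by simp
    show "integrable N (\<lambda>y. \<integral>y'. norm (case (y, y') of (y, y') \<Rightarrow> y * y') \<partial>N)"
      using int(1) by (simp add: abs_mult)
  qed auto
  have eq: "(\<lambda>(y :: real, y'). (y - y')\<^sup>2)
      = (\<lambda>p. (case p of (y, y') \<Rightarrow> y\<^sup>2) + (case p of (y, y') \<Rightarrow> y'\<^sup>2) - 2 * (case p of (y, y') \<Rightarrow> y * y'))"
    by (auto simp: fun_eq_iff power2_eq_square algebra_simps)
  show i: "integrable (N \<Otimes>\<^sub>M N) (\<lambda>(y, y'). (y - y')\<^sup>2)"
    unfolding eq using i1 i2 i3 by (intro Bochner_Integration.integrable_diff Bochner_Integration.integrable_add integrable_mult_right)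
  have "(\<integral>(y, y'). (y - y')\<^sup>2 \<partial>(N \<Otimes>\<^sub>M N))
     = (\<integral>p. (case p of (y, y') \<Rightarrow> y\<^sup>2) \<partial>(N \<Otimes>\<^sub>M N)) + (\<integral>p. (case p of (y, y') \<Rightarrow> y'\<^sup>2) \<partial>(N \<Otimes>\<^sub>M N))
       - 2 * (\<integral>p. (case p of (y, y') \<Rightarrow> y * y') \<partial>(N \<Otimes>\<^sub>M N))"
    unfolding eq using i1 i2 i3 by simp
  also have "(\<integral>p. (case p of (y, y') \<Rightarrow> y\<^sup>2) \<partial>(N \<Otimes>\<^sub>M N)) = (\<integral>y. y\<^sup>2 \<partial>N)"
    using NN.integral_fst'[OF i1] by (simp add: N.prob_space)
  also have "(\<integral>p. (case p of (y, y') \<Rightarrow> y'\<^sup>2) \<partial>(N \<Otimes>\<^sub>M N)) = (\<integral>y. y\<^sup>2 \<partial>N)"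
    using NN.integral_fst'[OF i2] by (simp add: N.prob_space)
  also have "(\<integral>p. (case p of (y, y') \<Rightarrow> y * y') \<partial>(N \<Otimes>\<^sub>M N)) = 0"
    using NN.integral_fst'[OF i3] mean by simp
  finally show "(\<integral>(y, y'). (y - y')\<^sup>2 \<partial>(N \<Otimes>\<^sub>M N)) = 2 * (\<integral>y. y\<^sup>2 \<partial>N)" by simp
qed

section \<open>Exponential moment of the truncated process\<close>

text \<open>The time indices in \<open>J\<close> contain every \<open>i - k\<close> with
  \<open>1 \<le> i \<le> n\<close> and \<open>k < K\<close>, so \<open>f\<close> depends on
  coordinates in \<open>J\<close> only. Bounded differences reduce the claim to a product of means
  of \<open>cosh\<close>, whose bound is free of \<open>K\<close>; this allows the later passage to
  the limit.\<close>

lemma exp_integral_truncated_le: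
  fixes N :: "real measure" and \<mu> :: "real ^ 'p::finite" and A :: "nat \<Rightarrow> real ^ 'p ^ 'p"
    and G :: "real ^ 'p \<Rightarrow> real" and g :: "real ^ 'p" and n K :: nat
  assumes N: "prob_space N" "sets N = sets borel"
    "integrable N (\<lambda>y. y)" "integrable N (\<lambda>y. y\<^sup>2)" "(\<integral>y. y \<partial>N) = 0"
    and \<rho>: "0 < \<rho>" "\<rho> < 1" and \<tau>: "1 \<le> \<tau>"
    and A: "\<And>k. onorm (\<lambda>v. A k *v v) \<le> \<gamma> * \<rho> powr (real k / \<tau>)"
    and M: "\<And>u. \<bar>G u\<bar> \<le> M"
    and g: "\<And>l. 0 \<le> g $ l" "(\<Sum>l\<in>UNIV. g $ l) = 1"
    and G: "\<And>u v. \<bar>G u - G v\<bar> \<le> (\<Sum>l\<in>UNIV. g $ l * \<bar>u $ l - v $ l\<bar>)"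
    and lam: "0 \<le> lam" "lam * (exp 1 * \<tau> * M / ln (1 / \<rho>)) < 1"
  defines "J \<equiv> {1 - int K..int n} \<times> (UNIV :: 'p set)"
    and "f \<equiv> \<lambda>z. lam * (\<Sum>i\<in>{1..int n}. G (\<mu> + (\<Sum>k<K. A k *v (\<chi> j. z (i - int k, j)))))"
  shows "(\<integral>z. exp (f z) \<partial>PiM J (\<lambda>_. N)) \<le> exp (\<integral>z. f z \<partial>PiM J (\<lambda>_. N)) *
    exp (2 * (\<integral>y. y\<^sup>2 \<partial>N) * (real n * \<gamma>\<^sup>2 * (exp 1 * \<tau> / (2 * ln (1 / \<rho>)))\<^sup>2 / \<rho>\<^sup>2 * lam\<^sup>2
        / (1 - lam * (exp 1 * \<tau> * M / ln (1 / \<rho>)))))"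
    and "f \<in> borel_measurable (PiM J (\<lambda>_. N))"
proof -
  interpret N: prob_space N by fact
  interpret NN: pair_prob_space N N ..
  note [measurable_cong] = N(2)
  have spN: "space N = UNIV" using sets_eq_imp_space_eq[OF N(2)] by simp
  \<comment> \<open>\<open>c i m j\<close> is the sensitivity of \<open>G\<close> at time
    \<open>i\<close> to the innovation \<open>(m, j)\<close>: the \<open>g\<close>-weighted column
    \<open>j\<close> of \<open>A (i - m)\<close>, and zero for innovations after time
    \<open>i\<close> or beyond the truncation.\<close>
  define c where "c i m j = (if m \<le> i \<and> i - m < int K
      then \<Sum>l\<in>UNIV. g $ l * \<bar>A (nat (i - m)) $ l $ j\<bar> else 0)" for i m :: int and j
  define W where "W s p = lam * (\<Sum>i\<in>{1..int n}. min (2 * M) (c i (fst s) (snd s) * \<bar>fst p - snd p\<bar>))"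
    for s and p :: "real \<times> real"
  define \<kappa> where "\<kappa> = real n * \<gamma>\<^sup>2 * (exp 1 * \<tau> / (2 * ln (1 / \<rho>)))\<^sup>2 / \<rho>\<^sup>2 * lam\<^sup>2
        / (1 - lam * (exp 1 * \<tau> * M / ln (1 / \<rho>)))"
  have M0: "0 \<le> M" using M[of 0] by linarith
  have finJ: "finite J" by (simp add: J_def)
  have c0: "0 \<le> c i m j" for i m j using g by (auto simp: c_def intro!: sum_nonneg)
  have c2: "(\<Sum>j\<in>UNIV. (c i m j)\<^sup>2) \<le> (\<gamma> * \<rho> powr (real (nat (i - m)) / \<tau>))\<^sup>2" for i m
  proof -
    have "(\<Sum>j\<in>UNIV. (c i m j)\<^sup>2) \<le> (\<Sum>j\<in>UNIV. (\<Sum>l\<in>UNIV. g $ l * \<bar>A (nat (i - m)) $ l $ j\<bar>)\<^sup>2)"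
      by (intro sum_mono) (auto simp: c_def)
    also have "\<dots> \<le> (onorm ((*v) (A (nat (i - m)))))\<^sup>2"
      by (rule weighted_column_norm_le_onorm[OF g])
    also have "\<dots> \<le> (\<gamma> * \<rho> powr (real (nat (i - m)) / \<tau>))\<^sup>2"
      using A by (intro power_mono onorm_pos_le matrix_vector_mul_bounded_linear)
    finally show ?thesis .
  qed
  have cosh_sum: "(\<Sum>s\<in>J. cosh (W s p) - 1) \<le> \<kappa> * (fst p - snd p)\<^sup>2" for p
  proof -
    have "(\<Sum>s\<in>J. cosh (W s p) - 1) = (\<Sum>(m, j)\<in>{1 - int K..int n} \<times> UNIV.
        cosh (lam * (\<Sum>i\<in>{1..int n}. min (2 * M) (c i m j * \<bar>fst p - snd p\<bar>))) - 1)"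
      by (simp add: J_def W_def case_prod_beta')
    also have "\<dots> \<le> real (card {1..int n}) * \<bar>fst p - snd p\<bar>\<^sup>2 * \<gamma>\<^sup>2 * (exp 1 * \<tau> / (2 * ln (1 / \<rho>)))\<^sup>2 / \<rho>\<^sup>2 * lam\<^sup>2
        / (1 - lam * (exp 1 * \<tau> * M / ln (1 / \<rho>)))"
      by (intro sum_cosh_clipped_le \<rho> \<tau> M0 lam c0 c2) (auto simp: c_def)
    also have "\<dots> = \<kappa> * (fst p - snd p)\<^sup>2" by (simp add: \<kappa>_def)
    finally show ?thesis .
  qed
  have W0: "0 \<le> W s p" for s p
    unfolding W_def using lam M0 c0 by (intro mult_nonneg_nonneg sum_nonneg) auto
  have W_le: "\<bar>W s p\<bar> \<le> lam * (real n * (2 * M))" for s p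
  proof -
    have "(\<Sum>i\<in>{1..int n}. min (2 * M) (c i (fst s) (snd s) * \<bar>fst p - snd p\<bar>)) \<le> (\<Sum>i\<in>{1..int n}. 2 * M)"
      by (intro sum_mono) auto
    then have "W s p \<le> lam * (real n * (2 * M))"
      unfolding W_def using lam by (intro mult_left_mono) auto
    then show ?thesis using W0[of s p] by simp
  qed
  have Wm[measurable]: "W s \<in> borel_measurable (N \<Otimes>\<^sub>M N)" for s
    unfolding W_def by measurable
  have Gm: "G \<in> borel_measurable borel"
    by (intro borel_measurable_continuous_onI continuous_on_weighted_l1_lipschitz[OF g(1) G])
  show fm: "f \<in> borel_measurable (PiM J (\<lambda>_. N))"
    unfolding f_def
  proof (intro borel_measurable_times borel_measurable_const borel_measurable_sum
      measurable_compose[OF _ Gm] borel_measurable_add borel_measurable_matrix_vector_mult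
      borel_measurable_vec_lambda)
    fix i k j assume "i \<in> {1..int n}" "k \<in> {..<K}"
    then have "(i - int k, j) \<in> J" by (auto simp: J_def)
    then show "(\<lambda>z. z (i - int k, j)) \<in> borel_measurable (PiM J (\<lambda>_. N))"
      using measurable_component_singleton[of "(i - int k, j)" J "\<lambda>_. N"] measurable_cong_sets[OF refl N(2)]
      by blast
  qed
  have f_le: "\<bar>f z\<bar> \<le> lam * (real n * M)" for z
  proof -
    have "\<bar>\<Sum>i\<in>{1..int n}. G (\<mu> + (\<Sum>k<K. A k *v (\<chi> j. z (i - int k, j))))\<bar> \<le> (\<Sum>i\<in>{1..int n}. M)"
      by (rule order_trans[OF sum_abs]) (intro sum_mono M)
    then show ?thesis
      unfolding f_def abs_mult using lam by (auto intro!: mult_left_mono)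
  qed
  have f_diff: "\<bar>f (z(s := y)) - f (z(s := y'))\<bar> \<le> W s (y, y')" for s z y y'
  proof -
    obtain m j where s: "s = (m, j)" by (cases s)
    define v where "v z i = \<mu> + (\<Sum>k<K. A k *v (\<chi> j. z (i - int k, j)))" for z and i :: int
    have G_diff: "\<bar>G (v (z(s := y)) i) - G (v (z(s := y')) i)\<bar> \<le> min (2 * M) (c i m j * \<bar>y - y'\<bar>)" for i
    proof -
      \<comment> \<open>Only the summand \<open>k = i - m\<close> sees the modified innovation, and
        only through column \<open>j\<close>.\<close>
      have comp: "v (z(s := y)) i $ l - v (z(s := y')) i $ l
          = (if m \<le> i \<and> i - m < int K then A (nat (i - m)) $ l $ j * (y - y') else 0)" for l
      proof -
        have "v (z(s := y)) i $ l - v (z(s := y')) i $ l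
            = (\<Sum>k<K. \<Sum>j'\<in>UNIV. A k $ l $ j' * ((z(s := y)) (i - int k, j') - (z(s := y')) (i - int k, j')))"
          by (simp add: v_def matrix_vector_mult_def right_diff_distrib sum_subtractf)
        also have "\<dots> = (\<Sum>k<K. \<Sum>j'\<in>UNIV. if j' = j then (if i - int k = m then A k $ l $ j * (y - y') else 0) else 0)"
          by (intro sum.cong refl) (auto simp: s)
        also have "\<dots> = (\<Sum>k<K. if i - int k = m then A k $ l $ j * (y - y') else 0)"
          by simp
        also have "\<dots> = (\<Sum>k<K. if k = nat (i - m) then (if m \<le> i then A k $ l $ j * (y - y') else 0) else 0)"
          by (intro sum.cong refl) auto
        also have "\<dots> = (if m \<le> i \<and> i - m < int K then A (nat (i - m)) $ l $ j * (y - y') else 0)"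
          by (auto simp: sum.delta)
        finally show ?thesis .
      qed
      have "\<bar>G (v (z(s := y)) i) - G (v (z(s := y')) i)\<bar>
          \<le> (\<Sum>l\<in>UNIV. g $ l * \<bar>v (z(s := y)) i $ l - v (z(s := y')) i $ l\<bar>)"
        by (rule G)
      also have "\<dots> = c i m j * \<bar>y - y'\<bar>"
        unfolding comp by (auto simp: c_def sum_distrib_right abs_mult mult.assoc)
      finally have "\<bar>G (v (z(s := y)) i) - G (v (z(s := y')) i)\<bar> \<le> c i m j * \<bar>y - y'\<bar>" .
      moreover have "\<bar>G (v (z(s := y)) i) - G (v (z(s := y')) i)\<bar> \<le> 2 * M"
        using M[of "v (z(s := y)) i"] M[of "v (z(s := y')) i"] by linarith
      ultimately show ?thesis by simp
    qed
    have "\<bar>f (z(s := y)) - f (z(s := y'))\<bar>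
        = lam * \<bar>\<Sum>i\<in>{1..int n}. G (v (z(s := y)) i) - G (v (z(s := y')) i)\<bar>"
      unfolding f_def v_def[symmetric] using lam
      by (simp add: abs_mult sum_subtractf flip: right_diff_distrib)
    also have "\<dots> \<le> lam * (\<Sum>i\<in>{1..int n}. min (2 * M) (c i m j * \<bar>y - y'\<bar>))"
      using lam by (intro mult_left_mono order_trans[OF sum_abs] sum_mono G_diff) auto
    finally show ?thesis by (simp add: W_def s)
  qed
  have int_cosh: "integrable (N \<Otimes>\<^sub>M N) (\<lambda>p. cosh (W s p))" for s
  proof (rule NN.P.integrable_const_bound)
    show "AE p in N \<Otimes>\<^sub>M N. norm (cosh (W s p)) \<le> cosh (lam * (real n * (2 * M)))"
    proof (rule AE_I2)
      fix p
      have "W s p \<le> lam * (real n * (2 * M))"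
        using W_le[of s p] by linarith
      then have "cosh (W s p) \<le> cosh (lam * (real n * (2 * M)))"
        using cosh_real_nonneg_le_iff W0 order_trans by blast
      then show "norm (cosh (W s p)) \<le> cosh (lam * (real n * (2 * M)))" by simp
    qed
    have "cosh \<in> borel_measurable (borel :: real measure)"
      by (intro borel_measurable_continuous_onI continuous_intros)
    then show "(\<lambda>p. cosh (W s p)) \<in> borel_measurable (N \<Otimes>\<^sub>M N)" by measurable
  qed
  \<comment> \<open>By \<open>1 + t \<le> exp t\<close> the product turns into the exponential of a
    sum. Every \<open>W s\<close> is a function of the same pair of reals, so the sum moves under
    one integral, where the pointwise bound \<open>cosh_sum\<close> applies.\<close>
  have "(\<Prod>s\<in>J. \<integral>p. cosh (W s p) \<partial>(N \<Otimes>\<^sub>M N)) \<le> (\<Prod>s\<in>J. exp (\<integral>p. cosh (W s p) - 1 \<partial>(N \<Otimes>\<^sub>M N)))"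
  proof (intro prod_mono conjI)
    fix s
    show "(\<integral>p. cosh (W s p) \<partial>(N \<Otimes>\<^sub>M N)) \<le> exp (\<integral>p. cosh (W s p) - 1 \<partial>(N \<Otimes>\<^sub>M N))"
      using exp_ge_add_one_self[of "\<integral>p. cosh (W s p) - 1 \<partial>(N \<Otimes>\<^sub>M N)"] int_cosh[of s]
      by (simp add: NN.P.prob_space)
  qed (auto intro!: integral_nonneg)
  also have "\<dots> = exp (\<integral>p. (\<Sum>s\<in>J. cosh (W s p) - 1) \<partial>(N \<Otimes>\<^sub>M N))"
    using finJ int_cosh by (subst Bochner_Integration.integral_sum) (auto simp: exp_sum)
  also have "\<dots> \<le> exp (\<integral>p. \<kappa> * (case p of (y, y') \<Rightarrow> (y - y')\<^sup>2) \<partial>(N \<Otimes>\<^sub>M N))"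
  proof (subst exp_le_cancel_iff, rule integral_mono)
    show "integrable (N \<Otimes>\<^sub>M N) (\<lambda>p. \<Sum>s\<in>J. cosh (W s p) - 1)"
      using int_cosh by (intro Bochner_Integration.integrable_sum Bochner_Integration.integrable_diff) auto
    show "integrable (N \<Otimes>\<^sub>M N) (\<lambda>p. \<kappa> * (case p of (y, y') \<Rightarrow> (y - y')\<^sup>2))"
      by (intro integrable_mult_right square_difference_expectation N)
  qed (use cosh_sum in \<open>simp add: case_prod_beta'\<close>)
  also have "\<dots> = exp (2 * (\<integral>y. y\<^sup>2 \<partial>N) * \<kappa>)"
    using square_difference_expectation(2)[OF N] by simp
  finally have prod_le: "(\<Prod>s\<in>J. \<integral>p. cosh (W s p) \<partial>(N \<Otimes>\<^sub>M N)) \<le> exp (2 * (\<integral>y. y\<^sup>2 \<partial>N) * \<kappa>)" .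
  have "(\<integral>z. exp (f z) \<partial>PiM J (\<lambda>_. N)) \<le> exp (\<integral>z. f z \<partial>PiM J (\<lambda>_. N)) *
      (\<Prod>s\<in>J. \<integral>p. cosh (W s p) \<partial>(N \<Otimes>\<^sub>M N))"
    by (rule exp_integral_PiM_bounded_differences[OF N(1) finJ Wm W_le fm f_le f_diff])
  also have "\<dots> \<le> exp (\<integral>z. f z \<partial>PiM J (\<lambda>_. N)) * exp (2 * (\<integral>y. y\<^sup>2 \<partial>N) * \<kappa>)"
    by (intro mult_left_mono prod_le) auto
  finally show "(\<integral>z. exp (f z) \<partial>PiM J (\<lambda>_. N)) \<le> exp (\<integral>z. f z \<partial>PiM J (\<lambda>_. N)) *
    exp (2 * (\<integral>y. y\<^sup>2 \<partial>N) * (real n * \<gamma>\<^sup>2 * (exp 1 * \<tau> / (2 * ln (1 / \<rho>)))\<^sup>2 / \<rho>\<^sup>2 * lam\<^sup>2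
        / (1 - lam * (exp 1 * \<tau> * M / ln (1 / \<rho>)))))"
    by (simp add: \<kappa>_def)
qed

section \<open>Choice of the exponent parameter and the constants\<close>

text \<open>For \<open>lam = 2 * x / D\<close>, Markov's inequality contributes
  \<open>- lam * x = - 2 * x ^ 2 / D\<close>, so the moment exponent may be as large as
  \<open>x ^ 2 / D\<close>. The first claim comes from the \<open>C2\<close> summand of
  \<open>D\<close>; the second comes from the \<open>C1\<close> summand together with the first
  claim.\<close>

lemma chernoff_exponent_le:
  fixes \<rho> \<tau> \<gamma> \<sigma> M x :: real and n :: nat
  assumes \<rho>: "0 < \<rho>" "\<rho> < 1" and \<tau>: "1 \<le> \<tau>" and M: "0 \<le> M" and x: "0 < x"
  defines "D \<equiv> C1 \<rho> * real n * \<sigma>\<^sup>2 * \<tau>\<^sup>2 * \<gamma>\<^sup>2 + C2 \<rho> * \<tau> * M * x"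
  assumes D: "0 < D"
  shows "2 * x / D * (exp 1 * \<tau> * M / ln (1 / \<rho>)) \<le> 1 / 4"
    and "2 * \<sigma>\<^sup>2 * (real n * \<gamma>\<^sup>2 * (exp 1 * \<tau> / (2 * ln (1 / \<rho>)))\<^sup>2 / \<rho>\<^sup>2 * (2 * x / D)\<^sup>2
        / (1 - 2 * x / D * (exp 1 * \<tau> * M / ln (1 / \<rho>)))) \<le> x\<^sup>2 / D"
proof -
  define L where "L = ln (1 / \<rho>)"
  define V where "V = real n * \<sigma>\<^sup>2 * \<tau>\<^sup>2 * \<gamma>\<^sup>2"
  define t where "t = 2 * x / D * (exp 1 * \<tau> * M / L)"
  have L: "0 < L" using \<rho> by (simp add: L_def)
  have V: "0 \<le> V" by (simp add: V_def)
  have C1: "0 \<le> C1 \<rho>" using \<rho> by (simp add: C1_def)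
  have C2: "0 \<le> C2 \<rho>" using \<rho> by (simp add: C2_def)
  have D_eq: "D = C1 \<rho> * V + C2 \<rho> * \<tau> * M * x" by (simp add: D_def V_def mult_ac)
  have "8 * exp 1 * \<tau> * M * x / L \<le> D"
    unfolding D_eq using C1 V by (simp add: C2_def L_def mult_ac)
  then show t: "2 * x / D * (exp 1 * \<tau> * M / ln (1 / \<rho>)) \<le> 1 / 4"
    using D L by (simp add: field_simps flip: L_def)
  \<comment> \<open>The argument produces \<open>\<rho> ^ 2 * L ^ 2\<close> in the denominator,
    \<open>C1\<close> has \<open>sqrt (2 * pi) * \<rho> ^ 4 * L ^ 3\<close>. The comparison requires
    \<open>sqrt (2 * pi) * \<rho> ^ 2 * L \<le> 6\<close>, where 6 is 16 divided by 8/3.\<close>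
  have "L \<le> 1 / \<rho>"
    unfolding L_def using ln_le_minus_one[of "1 / \<rho>"] \<rho> by simp
  then have "\<rho> * L \<le> 1" using \<rho> by (simp add: field_simps)
  then have "\<rho> * (\<rho> * L) \<le> 1 * 1"
    using \<rho> L by (intro mult_mono) auto
  moreover have "sqrt (2 * pi) \<le> 3"
    using pi_less_4 by (intro real_le_lsqrt) auto
  ultimately have "sqrt (2 * pi) * (\<rho> * (\<rho> * L)) \<le> 3 * 1"
    using \<rho> L by (intro mult_mono) auto
  then have s: "sqrt (2 * pi) * \<rho>\<^sup>2 * L \<le> 6" by (simp add: power2_eq_square)
  have "8 / 3 * (exp 1)\<^sup>2 / (L\<^sup>2 * \<rho>\<^sup>2)
      = 8 / 3 * (exp 1)\<^sup>2 * (sqrt (2 * pi) * \<rho>\<^sup>2 * L) / (sqrt (2 * pi) * \<rho> ^ 4 * L ^ 3)"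
    using \<rho> L by (simp add: power2_eq_square power3_eq_cube power4_eq_xxxx)
  also have "\<dots> \<le> 8 / 3 * (exp 1)\<^sup>2 * 6 / (sqrt (2 * pi) * \<rho> ^ 4 * L ^ 3)"
    using s \<rho> L by (intro divide_right_mono mult_left_mono) auto
  also have "\<dots> = C1 \<rho>" by (simp add: C1_def L_def)
  finally have "8 / 3 * (exp 1)\<^sup>2 / (L\<^sup>2 * \<rho>\<^sup>2) * V \<le> C1 \<rho> * V"
    using V by (rule mult_right_mono)
  also have "\<dots> \<le> D"
    unfolding D_eq using C2 \<tau> M x by simp
  finally have key: "8 / 3 * (exp 1)\<^sup>2 / (L\<^sup>2 * \<rho>\<^sup>2) * V \<le> D" .
  \<comment> \<open>Since \<open>t \<le> 1 / 4\<close>, the denominator is at least 3/4. The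
    constant 8/3 below is \<open>2 * (1 / 4) * 4 * (4 / 3)\<close>.\<close>
  have "2 * \<sigma>\<^sup>2 * (real n * \<gamma>\<^sup>2 * (exp 1 * \<tau> / (2 * L))\<^sup>2 / \<rho>\<^sup>2 * (2 * x / D)\<^sup>2 / (1 - t))
      \<le> 2 * \<sigma>\<^sup>2 * (real n * \<gamma>\<^sup>2 * (exp 1 * \<tau> / (2 * L))\<^sup>2 / \<rho>\<^sup>2 * (2 * x / D)\<^sup>2 / (3 / 4))"
    using t by (intro mult_left_mono divide_left_mono) (auto simp: t_def L_def)
  also have "\<dots> = 8 / 3 * (exp 1)\<^sup>2 / (L\<^sup>2 * \<rho>\<^sup>2) * V * (x\<^sup>2 / D\<^sup>2)"
    by (simp add: V_def power_divide power_mult_distrib field_simps)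
  also have "\<dots> \<le> D * (x\<^sup>2 / D\<^sup>2)"
    using key by (intro mult_right_mono) auto
  also have "\<dots> = x\<^sup>2 / D"
    using D by (simp add: power2_eq_square)
  finally show "2 * \<sigma>\<^sup>2 * (real n * \<gamma>\<^sup>2 * (exp 1 * \<tau> / (2 * ln (1 / \<rho>)))\<^sup>2 / \<rho>\<^sup>2 * (2 * x / D)\<^sup>2
        / (1 - 2 * x / D * (exp 1 * \<tau> * M / ln (1 / \<rho>)))) \<le> x\<^sup>2 / D"
    by (simp add: t_def L_def)
qed

section \<open>Almost sure convergence of the defining series\<close>

text \<open>By monotone convergence the sum has a finite integral, hence is finite almost
  everywhere.\<close>

lemma AE_summable_of_summable_integral:
  fixes f :: "nat \<Rightarrow> 'a \<Rightarrow> real"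
  assumes f: "\<And>k. integrable M (f k)" "\<And>k x. 0 \<le> f k x" and s: "summable (\<lambda>k. \<integral>x. f k x \<partial>M)"
  shows "AE x in M. summable (\<lambda>k. f k x)"
proof -
  have [measurable]: "f k \<in> borel_measurable M" for k using f(1) by auto
  have "(\<integral>\<^sup>+x. (\<Sum>k. ennreal (f k x)) \<partial>M) = (\<Sum>k. \<integral>\<^sup>+x. ennreal (f k x) \<partial>M)"
    by (intro nn_integral_suminf) auto
  also have "\<dots> = (\<Sum>k. ennreal (\<integral>x. f k x \<partial>M))"
    using f by (simp add: nn_integral_eq_integral)
  also have "\<dots> = ennreal (\<Sum>k. \<integral>x. f k x \<partial>M)"
    using f s by (intro suminf_ennreal2) auto
  finally have "AE x in M. (\<Sum>k. ennreal (f k x)) \<noteq> \<infinity>"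
    by (intro nn_integral_PInf_AE) auto
  then show ?thesis
    by eventually_elim (use f(2) in \<open>auto intro!: summable_suminf_not_top simp: top_ennreal_def\<close>)
qed

text \<open>The norms of the terms are dominated by \<open>a k * Y k\<close>, where \<open>a\<close>
  is geometric with ratio \<open>\<rho> powr (1 / \<tau>)\<close> and the l1 norms
  \<open>Y k\<close> of the innovations have uniformly bounded means.\<close>

lemma AE_summable_linear_process:
  fixes A :: "nat \<Rightarrow> real ^ 'p::finite ^ 'p" and \<epsilon> :: "int \<Rightarrow> 'p \<Rightarrow> 'a \<Rightarrow> real"
  assumes \<epsilon>: "\<And>i j. integrable P (\<epsilon> i j)" and b: "\<And>i j. (\<integral>\<omega>. \<bar>\<epsilon> i j \<omega>\<bar> \<partial>P) \<le> b"
    and \<rho>: "0 < \<rho>" "\<rho> < 1" and \<tau>: "0 < \<tau>"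
    and A: "\<And>k. onorm (\<lambda>v. A k *v v) \<le> \<gamma> * \<rho> powr (real k / \<tau>)"
  shows "AE \<omega> in P. summable (\<lambda>k. A k *v (\<chi> j. \<epsilon> (i - int k) j \<omega>))"
proof -
  define a where "a k = \<gamma> * \<rho> powr (real k / \<tau>)" for k :: nat
  define Y where "Y k \<omega> = (\<Sum>j\<in>UNIV. \<bar>\<epsilon> (i - int k) j \<omega>\<bar>)" for k :: nat and \<omega>
  have a0: "0 \<le> a k" for k
    unfolding a_def by (rule order_trans[OF onorm_pos_le A]) (rule matrix_vector_mul_bounded_linear)
  have "summable (\<lambda>k. \<gamma> * (\<rho> powr (1 / \<tau>)) ^ k)"
    using \<rho> \<tau> powr_less_mono'[of \<rho> 0 "1 / \<tau>"] by (intro summable_mult summable_geometric) auto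
  moreover have "(\<lambda>k. \<gamma> * (\<rho> powr (1 / \<tau>)) ^ k) = a"
    using \<rho> by (auto simp: a_def fun_eq_iff powr_powr simp flip: powr_realpow)
  ultimately have sa: "summable a" by simp
  have EY: "(\<integral>\<omega>. Y k \<omega> \<partial>P) \<le> real CARD('p) * b" for k
  proof -
    have "(\<integral>\<omega>. Y k \<omega> \<partial>P) = (\<Sum>j\<in>(UNIV :: 'p set). \<integral>\<omega>. \<bar>\<epsilon> (i - int k) j \<omega>\<bar> \<partial>P)"
      unfolding Y_def using \<epsilon> by simp
    also have "\<dots> \<le> (\<Sum>j\<in>(UNIV :: 'p set). b)" by (intro sum_mono b)
    finally show ?thesis by simp
  qed
  have "AE \<omega> in P. summable (\<lambda>k. a k * Y k \<omega>)"
  proof (rule AE_summable_of_summable_integral)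
    show "integrable P (\<lambda>\<omega>. a k * Y k \<omega>)" for k
      unfolding Y_def using \<epsilon> by simp
    show "summable (\<lambda>k. \<integral>\<omega>. a k * Y k \<omega> \<partial>P)"
    proof (rule summable_comparison_test')
      show "summable (\<lambda>k. a k * (real CARD('p) * b))" using sa by (rule summable_mult2)
      show "norm (\<integral>\<omega>. a k * Y k \<omega> \<partial>P) \<le> a k * (real CARD('p) * b)" for k
        using a0 EY by (auto simp: abs_mult Y_def sum_nonneg integral_nonneg intro!: mult_left_mono)
    qed
  qed (auto simp: Y_def intro!: mult_nonneg_nonneg a0 sum_nonneg)
  then show ?thesis
  proof eventually_elim
    case (elim \<omega>)
    show ?case
    proof (rule summable_comparison_test'[OF elim])
      fix k
      have "norm (A k *v (\<chi> j. \<epsilon> (i - int k) j \<omega>)) \<le> onorm ((*v) (A k)) * norm (\<chi> j. \<epsilon> (i - int k) j \<omega>)"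
        by (rule onorm) (rule matrix_vector_mul_bounded_linear)
      also have "\<dots> \<le> a k * Y k \<omega>"
        using A[of k] norm_le_l1_cart[of "\<chi> j. \<epsilon> (i - int k) j \<omega>"] a0
        by (intro mult_mono) (auto simp: a_def Y_def)
      finally show "norm (A k *v (\<chi> j. \<epsilon> (i - int k) j \<omega>)) \<le> a k * Y k \<omega>" .
    qed
  qed
qed

section \<open>Passage to the limit and Markov's inequality\<close>

theorem theorem2p2:
  fixes P :: "'a measure"
    and n :: nat
    and \<mu> :: "real ^ 'p::finite"
    and A :: "nat \<Rightarrow> real ^ 'p ^ 'p"
    and \<epsilon> :: "int \<Rightarrow> 'p \<Rightarrow> 'a \<Rightarrow> real"
    and X :: "int \<Rightarrow> 'a \<Rightarrow> real ^ 'p"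
    and \<sigma> \<rho>\<^sub>0 \<gamma> \<tau> M x :: real
    and G :: "real ^ 'p \<Rightarrow> real"
    and g :: "real ^ 'p"
  assumes "prob_space P"
    and "n \<ge> 1"
    and "prob_space.indep_vars P (\<lambda>_. borel) (\<lambda>(i, j). \<epsilon> i j) UNIV"
    and "\<And>i j i' j'. distr P borel (\<epsilon> i j) = distr P borel (\<epsilon> i' j')"
    and "\<And>i j. integrable P (\<epsilon> i j)"
    and "\<And>i j. prob_space.expectation P (\<epsilon> i j) = 0"
    and "\<And>i j. integrable P (\<lambda>\<omega>. (\<epsilon> i j \<omega>)\<^sup>2)"
    and "\<And>i j. prob_space.expectation P (\<lambda>\<omega>. (\<epsilon> i j \<omega>)\<^sup>2) = \<sigma>\<^sup>2"
    and "A 0 = mat 1"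
    and "X = linear_process \<mu> A \<epsilon>"
    and "0 < \<rho>\<^sub>0" and "\<rho>\<^sub>0 < 1"
    and "1 \<le> \<gamma>"
    and "1 \<le> \<tau>" and "\<tau> \<le> real n"
    and "\<And>k. onorm (\<lambda>v. A k *v v) \<le> \<gamma> * \<rho>\<^sub>0 powr (real k / \<tau>)"
    and "\<And>u. \<bar>G u\<bar> \<le> M"
    and "\<And>i. 0 \<le> g $ i" and "(\<Sum>i\<in>UNIV. g $ i) = 1"
    and "\<And>u v. \<bar>G u - G v\<bar> \<le> (\<Sum>i\<in>UNIV. g $ i * \<bar>u $ i - v $ i\<bar>)"
    and "x > 0"
  shows "prob_space.prob P
           {\<omega> \<in> space P. (\<Sum>i=1..n. G (X (int i) \<omega>) - prob_space.expectation P (\<lambda>\<omega>'. G (X (int i) \<omega>'))) \<ge> x}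
         \<le> 2 * exp (- (x\<^sup>2 / (C1 \<rho>\<^sub>0 * real n * \<sigma>\<^sup>2 * \<tau>\<^sup>2 * \<gamma>\<^sup>2 + C2 \<rho>\<^sub>0 * \<tau> * M * x)))"
proof -
  interpret prob_space P by fact
  note \<epsilon>_int = assms(5) and \<rho> = \<open>0 < \<rho>\<^sub>0\<close> \<open>\<rho>\<^sub>0 < 1\<close> and A_bound = assms(16) and M = assms(17)
    and g = assms(18,19) and G = assms(20)
  have \<epsilon>_meas[measurable]: "\<epsilon> i j \<in> borel_measurable P" for i j
    using \<epsilon>_int[of i j] by (rule borel_measurable_integrable)
  \<comment> \<open>Any coordinate index will do: all innovations share the law \<open>N\<close>
    defined next.\<close>
  obtain j\<^sub>0 :: 'p where True by simp
  define N where "N = distr P borel (\<epsilon> 0 j\<^sub>0)"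
  have distr_N: "distr P borel (\<epsilon> i j) = N" for i j
    unfolding N_def by (rule assms(4))
  have N: "prob_space N" "sets N = sets borel" "integrable N (\<lambda>y. y)" "integrable N (\<lambda>y. y\<^sup>2)"
      "(\<integral>y. y \<partial>N) = 0"
    using assms(5-7) by (auto simp: N_def integrable_distr_eq integral_distr intro!: prob_space_distr)
  have N_var: "(\<integral>y. y\<^sup>2 \<partial>N) = \<sigma>\<^sup>2"
    using assms(8) by (simp add: N_def integral_distr)
  have \<epsilon>_abs: "(\<integral>\<omega>. \<bar>\<epsilon> i j \<omega>\<bar> \<partial>P) = (\<integral>y. \<bar>y\<bar> \<partial>N)" for i j
    unfolding distr_N[of i j, symmetric] by (subst integral_distr) auto
  have M0: "0 \<le> M" using M[of 0] by linarith
  have Gm[measurable]: "G \<in> borel_measurable borel"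
    by (intro borel_measurable_continuous_onI continuous_on_weighted_l1_lipschitz[OF g(1) G])
  have [measurable]: "X i \<in> borel_measurable P" for i
    unfolding assms(10) linear_process_def[abs_def]
    by (intro borel_measurable_add borel_measurable_const borel_measurable_suminf
        borel_measurable_matrix_vector_mult borel_measurable_vec_lambda \<epsilon>_meas)
  define S where "S \<omega> = (\<Sum>i\<in>{1..int n}. G (X i \<omega>))" for \<omega>
  have S_meas[measurable]: "S \<in> borel_measurable P" unfolding S_def by measurable
  have sum_bound: "\<bar>\<Sum>i\<in>{1..int n}. G (u i)\<bar> \<le> real n * M" for u
  proof -
    have "\<bar>\<Sum>i\<in>{1..int n}. G (u i)\<bar> \<le> (\<Sum>i\<in>{1..int n}. M)"
      by (rule order_trans[OF sum_abs]) (intro sum_mono M)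
    then show ?thesis by simp
  qed
  define D where "D = C1 \<rho>\<^sub>0 * real n * \<sigma>\<^sup>2 * \<tau>\<^sup>2 * \<gamma>\<^sup>2 + C2 \<rho>\<^sub>0 * \<tau> * M * x"
  have D0: "0 \<le> D"
    unfolding D_def using \<rho> M0 \<open>1 \<le> \<tau>\<close> \<open>x > 0\<close> by (simp add: C1_def C2_def)
  have sum_eq: "(\<Sum>i=1..n. G (X (int i) \<omega>) - expectation (\<lambda>\<omega>'. G (X (int i) \<omega>'))) = S \<omega> - expectation S" for \<omega>
  proof -
    have "integrable P (\<lambda>\<omega>. G (X i \<omega>))" for i
      by (rule integrable_const_bound[where B = M]) (use M in auto)
    then have "expectation S = (\<Sum>i\<in>{1..int n}. expectation (\<lambda>\<omega>. G (X i \<omega>)))"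
      unfolding S_def by (intro Bochner_Integration.integral_sum)
    then have "S \<omega> - expectation S = (\<Sum>i\<in>{1..int n}. G (X i \<omega>) - expectation (\<lambda>\<omega>. G (X i \<omega>)))"
      by (simp add: S_def sum_subtractf)
    also have "{1..int n} = int ` {1..n}" by (simp add: image_int_atLeastAtMost)
    finally show ?thesis by (simp add: sum.reindex)
  qed
  show ?thesis
  proof (cases "D = 0")
    case True \<comment> \<open>division by zero makes the claimed bound equal to 2\<close>
    then show ?thesis
      unfolding D_def[symmetric] by (simp add: order_trans[OF prob_le_1])
  next
    case False
    then have D: "0 < D" using D0 by simp
    define lam where "lam = 2 * x / D"
    have lam: "0 < lam" using D \<open>x > 0\<close> by (simp add: lam_def)
    have exponent: "lam * (exp 1 * \<tau> * M / ln (1 / \<rho>\<^sub>0)) \<le> 1 / 4"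
        "2 * \<sigma>\<^sup>2 * (real n * \<gamma>\<^sup>2 * (exp 1 * \<tau> / (2 * ln (1 / \<rho>\<^sub>0)))\<^sup>2 / \<rho>\<^sub>0\<^sup>2 * lam\<^sup>2
          / (1 - lam * (exp 1 * \<tau> * M / ln (1 / \<rho>\<^sub>0)))) \<le> x\<^sup>2 / D"
      using chernoff_exponent_le[OF \<rho> \<open>1 \<le> \<tau>\<close> M0 \<open>x > 0\<close>, of n \<sigma> \<gamma>] D
      by (simp_all add: lam_def D_def)
    define v where "v K z i = \<mu> + (\<Sum>k<K. A k *v (\<chi> j. z (i - int k, j)))"
      for K :: nat and z and i :: int
    define T where "T K \<omega> = (\<Sum>i\<in>{1..int n}. G (v K (\<lambda>(i, j). \<epsilon> i j \<omega>) i))" for K \<omega>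
    have T_exp: "expectation (\<lambda>\<omega>. exp (lam * T K \<omega>)) \<le> exp (lam * expectation (T K)) * exp (x\<^sup>2 / D)"
      and T_meas: "T K \<in> borel_measurable P" for K
    proof -
      define J where "J = {1 - int K..int n} \<times> (UNIV :: 'p set)"
      define f where "f z = lam * (\<Sum>i\<in>{1..int n}. G (v K z i))" for z
      \<comment> \<open>\<open>R\<close> collects the innovations with index in \<open>J\<close>
        into one point of the product space. By independence and equality of the laws its
        distribution is the product of copies of \<open>N\<close>, so expectations of
        \<open>T K\<close> become product integrals.\<close>
      define R where "R \<omega> = (\<lambda>s\<in>J. (case s of (i, j) \<Rightarrow> \<epsilon> i j) \<omega>)" for \<omega>
      \<comment> \<open>The characterization of independence by the joint law asks for a nonempty
        index set. Time \<open>n\<close> occurs in \<open>J\<close> for every \<open>K\<close>,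
        including \<open>K = 0\<close>.\<close>
      have "J \<noteq> {}" using \<open>n \<ge> 1\<close> by (auto simp: J_def)
      have rv: "(case s of (i, j) \<Rightarrow> \<epsilon> i j) \<in> borel_measurable P" for s
        by (cases s) simp
      have R_meas: "R \<in> measurable P (PiM J (\<lambda>_. borel))"
        unfolding R_def by (intro measurable_restrict rv)
      have "indep_vars (\<lambda>_. borel) (\<lambda>(i, j). \<epsilon> i j) J"
        by (rule indep_vars_subset[OF assms(3)]) simp
      then have "distr P (PiM J (\<lambda>_. borel)) R = PiM J (\<lambda>s. distr P borel (case s of (i, j) \<Rightarrow> \<epsilon> i j))"
        unfolding R_def using indep_vars_iff_distr_eq_PiM[OF \<open>J \<noteq> {}\<close> rv] by simp
      also have "\<dots> = PiM J (\<lambda>_. N)"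
        by (intro PiM_cong) (auto simp: distr_N)
      finally have distr_R: "distr P (PiM J (\<lambda>_. borel)) R = PiM J (\<lambda>_. N)" .
      have "lam * (exp 1 * \<tau> * M / ln (1 / \<rho>\<^sub>0)) < 1" using exponent(1) by linarith
      note trunc = exp_integral_truncated_le[OF N \<rho> \<open>1 \<le> \<tau>\<close> A_bound M g G less_imp_le[OF lam] this,
          where n = n and K = K and \<mu> = \<mu>, folded v_def J_def, folded f_def]
      have f_meas: "f \<in> borel_measurable (PiM J (\<lambda>_. borel))"
        using trunc(2) measurable_cong_sets[OF sets_PiM_cong[OF refl N(2)] refl] by blast
      \<comment> \<open>Every \<open>i - k\<close> that occurs has its coordinates in
        \<open>J\<close>, so the default values of \<open>R\<close> outside \<open>J\<close> do not
        enter.\<close>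
      have v_R: "v K (R \<omega>) i = v K (\<lambda>(i, j). \<epsilon> i j \<omega>) i" if "i \<in> {1..int n}" for \<omega> i
        unfolding v_def using that
        by (intro arg_cong2[where f = "(+)"] refl sum.cong arg_cong2[where f = "(*v)"])
           (auto simp: vec_eq_iff R_def J_def)
      have f_R: "f (R \<omega>) = lam * T K \<omega>" for \<omega>
        unfolding f_def T_def by (simp add: v_R)
      have "(\<lambda>\<omega>. lam * T K \<omega>) \<in> borel_measurable P"
        using measurable_compose[OF R_meas f_meas] by (simp add: f_R)
      then have "(\<lambda>\<omega>. lam * T K \<omega> / lam) \<in> borel_measurable P" by (intro borel_measurable_divide) auto
      then show "T K \<in> borel_measurable P" using lam by simp
      have "expectation (\<lambda>\<omega>. exp (lam * T K \<omega>)) = (\<integral>z. exp (f z) \<partial>PiM J (\<lambda>_. N))"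
        unfolding distr_R[symmetric] using R_meas f_meas by (subst integral_distr) (auto simp: f_R)
      also have "\<dots> \<le> exp (\<integral>z. f z \<partial>PiM J (\<lambda>_. N)) * exp (x\<^sup>2 / D)"
        by (rule order_trans[OF trunc(1)]) (use exponent(2) in \<open>simp add: N_var\<close>)
      also have "(\<integral>z. f z \<partial>PiM J (\<lambda>_. N)) = lam * expectation (T K)"
        unfolding distr_R[symmetric] using R_meas f_meas by (subst integral_distr) (auto simp: f_R)
      finally show "expectation (\<lambda>\<omega>. exp (lam * T K \<omega>)) \<le> exp (lam * expectation (T K)) * exp (x\<^sup>2 / D)" .
    qed
    \<comment> \<open>There are countably many times, so one null set serves all \<open>i\<close>.
      Off it the \<open>suminf\<close> in \<open>linear_process\<close> is the limit of the partial
      sums.\<close>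
    have "AE \<omega> in P. \<forall>i. summable (\<lambda>k. A k *v (\<chi> j. \<epsilon> (i - int k) j \<omega>))"
      using \<open>1 \<le> \<tau>\<close> unfolding AE_all_countable
      by (intro allI AE_summable_linear_process[OF \<epsilon>_int eq_refl[OF \<epsilon>_abs] \<rho> _ A_bound]) auto
    then have lim: "AE \<omega> in P. (\<lambda>K. T K \<omega>) \<longlonglongrightarrow> S \<omega>"
    proof eventually_elim
      case (elim \<omega>)
      have X_lim: "(\<lambda>K. v K (\<lambda>(i, j). \<epsilon> i j \<omega>) i) \<longlonglongrightarrow> X i \<omega>" for i
        unfolding v_def assms(10) linear_process_def using summable_LIMSEQ[OF elim[rule_format, of i]]
        by (intro tendsto_add tendsto_const) simp
      have G_cont: "isCont G u" for u
        using continuous_on_weighted_l1_lipschitz[OF g(1) G] by (simp add: continuous_on_eq_continuous_at)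
      show ?case
        unfolding T_def S_def by (rule tendsto_sum) (rule isCont_tendsto_compose[OF G_cont X_lim])
    qed
    have T_le: "\<bar>T K \<omega>\<bar> \<le> real n * M" for K \<omega> unfolding T_def by (rule sum_bound)
    \<comment> \<open>Both limits of expectations follow by bounded convergence, as
      \<open>T K\<close> is bounded by \<open>n * M\<close> uniformly in \<open>K\<close>.\<close>
    have lim_E: "(\<lambda>K. expectation (T K)) \<longlonglongrightarrow> expectation S"
      by (rule integral_dominated_convergence[where w = "\<lambda>_. real n * M"])
         (use lim T_le T_meas in auto)
    have lim_exp: "(\<lambda>K. expectation (\<lambda>\<omega>. exp (lam * T K \<omega>))) \<longlonglongrightarrow> expectation (\<lambda>\<omega>. exp (lam * S \<omega>))"
    proof (rule integral_dominated_convergence[where w = "\<lambda>_. exp (lam * (real n * M))"])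
      show "AE \<omega> in P. (\<lambda>K. exp (lam * T K \<omega>)) \<longlonglongrightarrow> exp (lam * S \<omega>)"
        using lim by eventually_elim (intro tendsto_intros)
      show "AE \<omega> in P. norm (exp (lam * T K \<omega>)) \<le> exp (lam * (real n * M))" for K
        using T_le lam by (intro AE_I2) (auto simp: abs_le_iff)
      show "(\<lambda>\<omega>. exp (lam * T K \<omega>)) \<in> borel_measurable P" for K
        using T_meas[of K] by measurable
    qed auto
    have S_exp: "expectation (\<lambda>\<omega>. exp (lam * S \<omega>)) \<le> exp (lam * expectation S) * exp (x\<^sup>2 / D)"
      by (rule LIMSEQ_le[OF lim_exp tendsto_mult[OF tendsto_exp[OF tendsto_mult[OF tendsto_const lim_E]] tendsto_const]])
         (use T_exp in auto)
    have S_le: "S \<omega> \<le> real n * M" for \<omega>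
      using sum_bound[of "\<lambda>i. X i \<omega>"] by (simp add: S_def abs_le_iff)
    \<comment> \<open>The increasing map \<open>exp (lam * _)\<close> rewrites the event in the form
      to which Markov's inequality applies.\<close>
    have "prob {\<omega> \<in> space P. x \<le> S \<omega> - expectation S}
        = prob {\<omega> \<in> space P. exp (lam * (x + expectation S)) \<le> exp (lam * S \<omega>)}"
      using lam by (intro arg_cong[where f = prob] Collect_cong) auto
    also have "\<dots> \<le> expectation (\<lambda>\<omega>. exp (lam * S \<omega>)) / exp (lam * (x + expectation S))"
    proof (rule integral_Markov_inequality_measure[where A = "{}"])
      show "integrable P (\<lambda>\<omega>. exp (lam * S \<omega>))"
        by (rule integrable_const_bound[where B = "exp (lam * (real n * M))"]) (use S_le lam in auto)
    qed auto
    also have "\<dots> \<le> exp (lam * expectation S) * exp (x\<^sup>2 / D) / exp (lam * (x + expectation S))"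
      by (intro divide_right_mono S_exp) auto
    also have "\<dots> = exp (x\<^sup>2 / D - lam * x)"
      by (simp add: distrib_left flip: exp_add exp_diff)
    also have "x\<^sup>2 / D - lam * x = - (x\<^sup>2 / D)"
      by (simp add: lam_def power2_eq_square)
    also have "exp (- (x\<^sup>2 / D)) \<le> 2 * exp (- (x\<^sup>2 / D))" by simp
    finally show ?thesis
      unfolding sum_eq D_def .
  qed
qed

end
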